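(* Let $\mathcal B=\bigcup_{m\geq 0}\{\widetilde\chi_m(1),\widetilde\chi_m(21),\widetilde\chi_m(2431)\}$. Let $\tau^{(1)},\tau^{(2)},\ldots$ be a (possibly empty, possibly infinite) list of patterns from $\mathcal B$, and let $\tau'^{(i)}=\operatorname{swl}(\tau^{(i)})$ for all $i$. For every $n\geq 0$, the statistics $\operatorname{des}$, $\operatorname{peak}$, and $\operatorname{zeil}$ are jointly equidistributed on $s^{-1}(\operatorname{Av}_n(132,3412,\tau^{(1)},\tau^{(2)},\ldots))$ and $s^{-1}(\operatorname{Av}_n(312,1342,\tau'^{(1)},\tau'^{(2)},\ldots))$.
   Context: $S_n$ is the set of permutations of $[n]$ in one-line notation; $\operatorname{Av}_n(\ldots)$ is the set of permutations in $S_n$ avoiding all listed patterns. Stack-sorting map: $s(\text{empty})=\text{empty}$, $s(LnR)=s(L)s(R)n$ with $n$ the largest entry. For $\pi\in S_n$ and $m\ge0$, $\chi_m(\pi)=(n+m-1)\cdots(n+3)(n+1)\,\pi\,(n+2)(n+4)\cdots(n+m)$ if $m$ is even and $(n+m)\cdots(n+3)(n+1)\,\pi\,(n+2)(n+4)\cdots(n+m-1)$ if $m$ is odd. $\operatorname{rot}(\pi)$ is the reverse of the inverse of $\pi$, and $\widetilde\chi_m(\pi)=\operatorname{rot}^{-1}(\chi_m(\operatorname{rot}(\pi)))$. Direct sum $\lambda\oplus\mu$ places $\mu$ above-right of $\lambda$; skew sum $\lambda\ominus\mu$ places $\mu$ below-right of $\lambda$. $\operatorname{swu}$ on normalized $231$-avoiding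 permutations: fixes the empty permutation; for nonempty $\pi=L\oplus(1\ominus R)$, $\operatorname{swu}(\pi)=(\operatorname{swu}(L)\oplus1)\ominus\operatorname{swu}(R)$. For $132$-avoiding $\pi$, $\operatorname{swl}(\pi)=\operatorname{rot}^{-1}(\operatorname{swu}(\operatorname{rot}(\pi)))$. For $\pi\in S_n$: $\operatorname{des}(\pi)$ is the number of $i$ with $\pi_i>\pi_{i+1}$; $\operatorname{peak}(\pi)$ is the number of $i\in\{2,\ldots,n-1\}$ with $\pi_{i-1}<\pi_i>\pi_{i+1}$; $\operatorname{zeil}(\pi)$ is the largest $m$ such that $n,n-1,\ldots,n-m+1$ appear in decreasing order in $\pi$. Joint equidistribution on $A,A'$ means a single bijection $A\to A'$ preserves all three statistics.
   Formalization: swl is defined only on 132-avoiding permutations, but every χ̃_m(2431) contains 132, so swl(τ^(i)) is undefined for these; the formal statement keeps only those τ'^(i) = swl(τ^(i)) for which τ^(i) avoids 132, and the χ̃_m(2431) then impose no condition. *)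

theory Defs
  imports "HOL-Library.Sublist" "HOL-Combinatorics.Multiset_Permutations"
begin

text \<open>A permutation of \<open>[n]\<close> in one-line notation is a list over \<open>{1..n}\<close> in which every element
  occurs exactly once. List positions are counted from 0.\<close>

abbreviation perms :: "nat \<Rightarrow> nat list set" where
  "perms n \<equiv> permutations_of_set {1..n}"

definition order_isomorphic :: "nat list \<Rightarrow> nat list \<Rightarrow> bool" where
  "order_isomorphic xs ys \<longleftrightarrow> length xs = length ys \<and>
     (\<forall>i < length xs. \<forall>j < length xs. xs ! i < xs ! j \<longleftrightarrow> ys ! i < ys ! j)"

definition avoids :: "nat list \<Rightarrow> nat list \<Rightarrow> bool" where
  "avoids \<pi> \<tau> \<longleftrightarrow> \<not> (\<exists>xs. subseq xs \<pi> \<and> order_isomorphic xs \<tau>)"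

definition Av :: "nat \<Rightarrow> nat list set \<Rightarrow> nat list set" where
  "Av n T = {\<pi> \<in> perms n. \<forall>\<tau> \<in> T. avoids \<pi> \<tau>}"

function stack_sort :: "nat list \<Rightarrow> nat list" where
  "stack_sort \<pi> = (if \<pi> = [] then [] else
     let n = Max (set \<pi>);
         L = takeWhile (\<lambda>x. x \<noteq> n) \<pi>;
         R = tl (dropWhile (\<lambda>x. x \<noteq> n) \<pi>)
     in stack_sort L @ stack_sort R @ [n])"
  by auto

lemma length_takeWhile_Max:
  assumes "\<pi> \<noteq> []"
  shows "length (takeWhile (\<lambda>x. x \<noteq> Max (set \<pi>)) \<pi>) < length \<pi>"
proof (rule ccontr)
  let ?P = "\<lambda>x. x \<noteq> Max (set \<pi>)"
  assume "\<not> ?thesis"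
  then have "takeWhile ?P \<pi> = \<pi>"
    by (metis linorder_not_less takeWhile_eq_take take_all)
  then have "\<forall>x \<in> set \<pi>. ?P x"
    by (metis set_takeWhileD)
  moreover have "Max (set \<pi>) \<in> set \<pi>"
    using assms by simp
  ultimately show False by blast
qed

lemma length_tl_dropWhile:
  assumes "\<pi> \<noteq> []"
  shows "length (dropWhile P \<pi>) - Suc 0 < length \<pi>"
  using assms length_dropWhile_le[of P \<pi>] by (cases \<pi>) (auto simp: less_Suc_eq_le)

termination stack_sort
  by (relation "measure length") (auto simp: length_takeWhile_Max length_tl_dropWhile)

declare stack_sort.simps [simp del]

definition stack_sort_preimage :: "nat list set \<Rightarrow> nat list set" where
  "stack_sort_preimage X = {\<sigma>. (\<exists>n. \<sigma> \<in> perms n) \<and> stack_sort \<sigma> \<in> X}"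

definition oplus :: "nat list \<Rightarrow> nat list \<Rightarrow> nat list" (infixr \<open>\<oplus>\<close> 65) where
  "\<alpha> \<oplus> \<beta> = \<alpha> @ map (\<lambda>x. x + length \<alpha>) \<beta>"

definition ominus :: "nat list \<Rightarrow> nat list \<Rightarrow> nat list" (infixr \<open>\<ominus>\<close> 65) where
  "\<alpha> \<ominus> \<beta> = map (\<lambda>x. x + length \<beta>) \<alpha> @ \<beta>"

definition inv_perm :: "nat list \<Rightarrow> nat list" where
  "inv_perm \<pi> = map (\<lambda>j. Suc (THE i. i < length \<pi> \<and> \<pi> ! i = j)) [1..<Suc (length \<pi>)]"

definition rot :: "nat list \<Rightarrow> nat list" where
  "rot \<pi> = rev (inv_perm \<pi>)"

text \<open>The inverse of \<open>rot\<close> on permutations; see \<open>rot_inv_rot\<close> and \<open>rot_rot_inv\<close> below.\<close>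

definition rot_inv :: "nat list \<Rightarrow> nat list" where
  "rot_inv \<pi> = inv_perm (rev \<pi>)"

definition chi :: "nat \<Rightarrow> nat list \<Rightarrow> nat list" where
  "chi m \<pi> = rev (map (\<lambda>k. length \<pi> + k) (filter odd [1..<Suc m])) @ \<pi> @
             map (\<lambda>k. length \<pi> + k) (filter even [1..<Suc m])"

definition chi_tilde :: "nat \<Rightarrow> nat list \<Rightarrow> nat list" where
  "chi_tilde m \<pi> = rot_inv (chi m (rot \<pi>))"

definition \<B> :: "nat list set" where
  "\<B> = (\<Union>m. {chi_tilde m [1], chi_tilde m [2, 1], chi_tilde m [2, 4, 3, 1]})"

text \<open>A nonempty permutation avoiding 231 is uniquely \<open>L \<oplus> ([1] \<ominus> R)\<close>: \<open>L\<close> is the part to the left of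
  the largest entry, and the part to its right, all of whose entries exceed those of \<open>L\<close>, is \<open>R\<close>
  shifted up by \<open>length L\<close>. The value of \<open>swu\<close> has no meaning on a list that is not a
  231-avoiding permutation. The defining recursion is the lemma \<open>swu_oplus\<close> below.\<close>

function swu :: "nat list \<Rightarrow> nat list" where
  "swu \<pi> = (if \<pi> = [] then [] else
     let n = Max (set \<pi>);
         L = takeWhile (\<lambda>x. x \<noteq> n) \<pi>;
         R = map (\<lambda>x. x - length L) (tl (dropWhile (\<lambda>x. x \<noteq> n) \<pi>))
     in (swu L \<oplus> [1]) \<ominus> swu R)"
  by auto
termination
  by (relation "measure length") (auto simp: length_takeWhile_Max length_tl_dropWhile)

declare swu.simps [simp del]

text \<open>Meaningful only on permutations that avoid 132 (those that \<open>rot\<close> sends to 231-avoiding ones).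
  Not every element of \<open>\<B>\<close> is in this domain: \<open>chi_tilde m [2, 4, 3, 1]\<close> contains 2431, hence 132.\<close>

definition swl :: "nat list \<Rightarrow> nat list" where
  "swl \<pi> = rot_inv (swu (rot \<pi>))"

definition des :: "nat list \<Rightarrow> nat" where
  "des \<pi> = card {i. Suc i < length \<pi> \<and> \<pi> ! i > \<pi> ! Suc i}"

definition peak :: "nat list \<Rightarrow> nat" where
  "peak \<pi> = card {i. 0 < i \<and> Suc i < length \<pi> \<and> \<pi> ! (i - 1) < \<pi> ! i \<and> \<pi> ! i > \<pi> ! Suc i}"

text \<open>With \<open>n = length \<pi>\<close>, the list \<open>rev [Suc n - m..<Suc n]\<close> is \<open>n, n-1, \<dots>, n-m+1\<close>.\<close>

definition zeil :: "nat list \<Rightarrow> nat" where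
  "zeil \<pi> = Max {m. m \<le> length \<pi> \<and> subseq (rev [Suc (length \<pi>) - m..<Suc (length \<pi>)]) \<pi>}"

definition jointly_equidistributed :: "nat list set \<Rightarrow> nat list set \<Rightarrow> bool" where
  "jointly_equidistributed A A' \<longleftrightarrow> (\<exists>f. bij_betw f A A' \<and>
     (\<forall>\<sigma> \<in> A. des (f \<sigma>) = des \<sigma> \<and> peak (f \<sigma>) = peak \<sigma> \<and> zeil (f \<sigma>) = zeil \<sigma>))"

lemma permsD:
  assumes "\<pi> \<in> perms n"
  shows "set \<pi> = {1..n}" "distinct \<pi>" "length \<pi> = n"
  using assms distinct_card[of \<pi>] by (auto simp: permutations_of_set_def)

lemma stack_sort_Nil: "stack_sort [] = []"
  by (simp add: stack_sort.simps)

lemma stack_sort_append: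
  assumes "\<forall>x \<in> set L \<union> set R. x < n"
  shows "stack_sort (L @ n # R) = stack_sort L @ stack_sort R @ [n]"
proof -
  have M: "Max (set (L @ n # R)) = n"
    using assms by (intro Max_eqI) (auto simp: less_imp_le)
  have "takeWhile (\<lambda>x. x \<noteq> n) (L @ n # R) = L" "dropWhile (\<lambda>x. x \<noteq> n) (L @ n # R) = n # R"
    using assms by (auto simp: takeWhile_append dropWhile_append)
  then show ?thesis
    by (subst stack_sort.simps) (simp only: M Let_def, simp)
qed

lemma swu_Nil: "swu [] = []"
  by (simp add: swu.simps)

lemma swu_oplus:
  assumes L: "L \<in> perms k" and R: "R \<in> perms l"
  shows "swu (L \<oplus> ([1] \<ominus> R)) = (swu L \<oplus> [1]) \<ominus> swu R"
proof -
  let ?n = "Suc (l + k)"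
  note L' = permsD[OF L] and R' = permsD[OF R]
  have eq: "L \<oplus> ([1] \<ominus> R) = L @ ?n # map (\<lambda>x. x + k) R"
    by (simp add: oplus_def ominus_def L'(3) R'(3))
  have M: "Max (set (L @ ?n # map (\<lambda>x. x + k) R)) = ?n"
    by (intro Max_eqI) (auto simp: L'(1) R'(1))
  have n: "?n \<notin> set L"
    by (simp add: L'(1))
  have "takeWhile (\<lambda>x. x \<noteq> ?n) (L @ ?n # map (\<lambda>x. x + k) R) = L"
    "dropWhile (\<lambda>x. x \<noteq> ?n) (L @ ?n # map (\<lambda>x. x + k) R) = ?n # map (\<lambda>x. x + k) R"
    using n by (auto simp: takeWhile_append dropWhile_append)
  then show ?thesis
    unfolding eq by (subst swu.simps) (simp only: M Let_def, simp add: L'(3) o_def)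
qed

lemma inv_perm_nth:
  assumes "\<pi> \<in> perms n" and "i < n"
  shows "inv_perm \<pi> ! (\<pi> ! i - 1) = Suc i"
proof -
  note p = permsD[OF assms(1)]
  have "\<pi> ! i \<in> {1..n}"
    using nth_mem[of i \<pi>] assms(2) p by simp
  then have "inv_perm \<pi> ! (\<pi> ! i - 1) = Suc (THE i'. i' < n \<and> \<pi> ! i' = \<pi> ! i)"
    by (auto simp: inv_perm_def p(3) simp del: upt_Suc)
  also have "(THE i'. i' < n \<and> \<pi> ! i' = \<pi> ! i) = i"
    using assms(2) p by (intro the_equality) (auto simp: nth_eq_iff_index_eq)
  finally show ?thesis .
qed

lemma length_inv_perm [simp]: "length (inv_perm \<pi>) = length \<pi>"
  by (simp add: inv_perm_def del: upt_Suc)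

lemma inv_perm_in_perms:
  assumes "\<pi> \<in> perms n"
  shows "inv_perm \<pi> \<in> perms n"
proof -
  note p = permsD[OF assms]
  have "{1..n} \<subseteq> set (inv_perm \<pi>)"
  proof
    fix x assume x: "x \<in> {1..n}"
    then have "x - 1 < n" by auto
    moreover from this have "\<pi> ! (x - 1) \<in> {1..n}"
      using nth_mem[of "x - 1" \<pi>] p by simp
    ultimately show "x \<in> set (inv_perm \<pi>)"
      using inv_perm_nth[OF assms, of "x - 1"] x p(3)
        nth_mem[of "\<pi> ! (x - 1) - 1" "inv_perm \<pi>"] by auto
  qed
  moreover have "card (set (inv_perm \<pi>)) \<le> n"
    using card_length[of "inv_perm \<pi>"] p(3) by simp
  ultimately have s: "set (inv_perm \<pi>) = {1..n}"
    using card_seteq[of "set (inv_perm \<pi>)" "{1..n}"] by simp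
  moreover from this have "distinct (inv_perm \<pi>)"
    using p(3) by (intro card_distinct) simp
  ultimately show ?thesis
    by (simp add: permutations_of_set_def)
qed

lemma inv_perm_inv_perm:
  assumes "\<pi> \<in> perms n"
  shows "inv_perm (inv_perm \<pi>) = \<pi>"
proof (rule nth_equalityI)
  fix i assume "i < length (inv_perm (inv_perm \<pi>))"
  then have i: "i < n" by (simp add: permsD(3)[OF assms])
  have v: "\<pi> ! i \<in> {1..n}"
    using nth_mem[of i \<pi>] i permsD[OF assms] by simp
  then have "inv_perm (inv_perm \<pi>) ! (inv_perm \<pi> ! (\<pi> ! i - 1) - 1) = Suc (\<pi> ! i - 1)"
    by (intro inv_perm_nth[OF inv_perm_in_perms[OF assms]]) auto
  then show "inv_perm (inv_perm \<pi>) ! i = \<pi> ! i"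
    using v inv_perm_nth[OF assms i] by simp
qed simp

lemma rot_inv_rot:
  assumes "\<pi> \<in> perms n"
  shows "rot_inv (rot \<pi>) = \<pi>"
  using inv_perm_inv_perm[OF assms] by (simp add: rot_def rot_inv_def)

lemma rot_rot_inv:
  assumes "\<pi> \<in> perms n"
  shows "rot (rot_inv \<pi>) = \<pi>"
proof -
  have "rev \<pi> \<in> perms n"
    using assms by (auto simp: permutations_of_set_def)
  from inv_perm_inv_perm[OF this] show ?thesis
    by (simp add: rot_def rot_inv_def)
qed

end

theory Submission
  imports Defs
begin

text \<open>Write \<open>A > p > B\<close> when all entries of \<open>A\<close> exceed \<open>p\<close> and all entries of \<open>B\<close> are below \<open>p\<close>. A word with
  last entry \<open>p\<close> that avoids 132 is \<open>A B p\<close> with \<open>A > p > B\<close>; swinging it recursively to \<open>B' A' p\<close>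
  without renaming the entries is the map \<open>swl\<close>. If the word also avoids 3412, then \<open>B\<close> is empty or \<open>A\<close>
  is decreasing, and the images are exactly the words avoiding 312 and 1342.

  Consider all forests for \<open>w\<close>, that is, lists of nonempty words whose stack-sorted images concatenate
  to \<open>w\<close>. Appending a new maximum to \<open>w\<close> changes the number of words, the descents and the peaks of the
  forests in a way that depends only on these statistics, because the new maximum absorbs the last words
  of the forest as its left and right part. If the last entry of \<open>w\<close> exceeds \<open>p\<close>, then \<open>p\<close> can only
  be a word by itself in a forest for \<open>w p\<close>; and the entries of a decreasing prefix above everything else
  are words by themselves too. Hence the forests for \<open>w\<close> and its swung image are equidistributed,
  and the forests with a single word give the fibers of \<open>s\<close>. The statistic \<open>zeil\<close> can be followed along
  the maximal terminal run of successive maxima only, which is all that it sees.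

  The elements of \<open>\<B>\<close> that avoid 132 arise from 1 by appending alternately a new maximum and a new minimum.
  They are fixed by \<open>swl\<close>, and swinging neither creates nor destroys such a pattern. The remaining elements
  of \<open>\<B>\<close> contain 132 and impose no condition.\<close>

section \<open>Stack-sorting and the three statistics\<close>

lemma stack_sort_Max_decomp:
  assumes "\<sigma> \<noteq> []"
  shows "takeWhile (\<lambda>x. x \<noteq> Max (set \<sigma>)) \<sigma> @ Max (set \<sigma>) # tl (dropWhile (\<lambda>x. x \<noteq> Max (set \<sigma>)) \<sigma>) = \<sigma>"
proof -
  let ?P = "\<lambda>x. x \<noteq> Max (set \<sigma>)"
  have "\<exists>x \<in> set \<sigma>. \<not> ?P x"
    using assms by (intro bexI[of _ "Max (set \<sigma>)"]) auto
  then have ne: "dropWhile ?P \<sigma> \<noteq> []"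
    by auto
  then have "hd (dropWhile ?P \<sigma>) = Max (set \<sigma>)"
    using hd_dropWhile by blast
  then have "Max (set \<sigma>) # tl (dropWhile ?P \<sigma>) = dropWhile ?P \<sigma>"
    using ne by (metis list.collapse)
  then show ?thesis
    by simp
qed

lemma mset_stack_sort [simp]: "mset (stack_sort \<sigma>) = mset \<sigma>"
proof (induction \<sigma> rule: stack_sort.induct)
  case (1 \<sigma>)
  show ?case
  proof (cases "\<sigma> = []")
    case False
    let ?n = "Max (set \<sigma>)"
    let ?L = "takeWhile (\<lambda>x. x \<noteq> ?n) \<sigma>" and ?R = "tl (dropWhile (\<lambda>x. x \<noteq> ?n) \<sigma>)"
    have "mset (stack_sort \<sigma>) = mset ?L + mset ?R + {#?n#}"
      using 1[OF False refl refl refl] False by (subst stack_sort.simps) (simp add: Let_def)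
    also have "\<dots> = mset (?L @ ?n # ?R)"
      by simp
    finally show ?thesis
      unfolding stack_sort_Max_decomp[OF False] .
  qed (simp add: stack_sort_Nil)
qed

lemma set_stack_sort [simp]: "set (stack_sort \<sigma>) = set \<sigma>"
  by (metis mset_stack_sort set_mset_mset)

lemma length_stack_sort [simp]: "length (stack_sort \<sigma>) = length \<sigma>"
  by (metis mset_stack_sort size_mset)

lemma distinct_stack_sort [simp]: "distinct (stack_sort \<sigma>) = distinct \<sigma>"
  by (metis mset_stack_sort mset_eq_imp_distinct_iff)

lemma stack_sort_eq_Nil_iff [simp]: "stack_sort \<sigma> = [] \<longleftrightarrow> \<sigma> = []"
  by (metis length_0_conv length_stack_sort)

lemma last_stack_sort:
  "\<sigma> \<noteq> [] \<Longrightarrow> last (stack_sort \<sigma>) = Max (set \<sigma>)"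
  by (subst stack_sort.simps) (simp add: Let_def)

lemma stack_sort_singleton: "stack_sort [a] = [a]"
  using stack_sort_append[of "[]" "[]" a] by (simp add: stack_sort_Nil)

lemma stack_sort_eq_singleton_iff [simp]: "stack_sort \<sigma> = [a] \<longleftrightarrow> \<sigma> = [a]"
proof
  assume "stack_sort \<sigma> = [a]"
  then have "mset \<sigma> = {#a#}"
    using mset_stack_sort[of \<sigma>] by simp
  then show "\<sigma> = [a]"
    by simp
qed (simp add: stack_sort_singleton)

lemma max_last_decomp:
  fixes \<sigma> :: "nat list"
  assumes "distinct \<sigma>" "m \<in> set \<sigma>" "\<forall>x \<in> set \<sigma>. x \<le> m"
  obtains L R where "\<sigma> = L @ m # R" "\<forall>x \<in> set L \<union> set R. x < m"
proof -
  obtain L R where \<sigma>: "\<sigma> = L @ m # R"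
    using assms(2) by (meson split_list)
  moreover have "x < m" if "x \<in> set L \<union> set R" for x
  proof -
    have "x \<in> set \<sigma>" "x \<noteq> m"
      using that assms(1) \<sigma> by auto
    with assms(3) show ?thesis
      using le_neq_implies_less by blast
  qed
  ultimately show thesis
    using that by blast
qed

section \<open>The statistics of a word cut at its maximum\<close>

lemma des_Cons2: "des (x # y # zs) = of_bool (x > y) + des (y # zs)"
proof -
  let ?S = "\<lambda>\<pi>. {i. Suc i < length \<pi> \<and> \<pi> ! i > \<pi> ! Suc i}"
  have "i \<in> ?S (x # y # zs) \<longleftrightarrow> i \<in> (if x > y then {0} else {}) \<union> Suc ` ?S (y # zs)" for i
    by (cases i) (simp_all add: inj_image_mem_iff)
  then have "?S (x # y # zs) = (if x > y then {0} else {}) \<union> Suc ` ?S (y # zs)"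
    by blast
  moreover have "finite (?S (y # zs))"
    by (rule finite_subset[of _ "{..<length (y # zs)}"]) auto
  ultimately show ?thesis
    unfolding des_def by (auto simp: card_image card_insert_if)
qed

lemma peak_Cons3: "peak (x # y # z # zs) = of_bool (x < y \<and> z < y) + peak (y # z # zs)"
proof -
  let ?S = "\<lambda>\<pi>. {i. 0 < i \<and> Suc i < length \<pi> \<and> \<pi> ! (i - 1) < \<pi> ! i \<and> \<pi> ! i > \<pi> ! Suc i}"
  have "i \<in> ?S (x # y # z # zs) \<longleftrightarrow> i \<in> (if x < y \<and> z < y then {1} else {}) \<union> Suc ` ?S (y # z # zs)" for i
    by (cases i; cases "i - 1") (auto simp: image_iff)
  then have "?S (x # y # z # zs) = (if x < y \<and> z < y then {1} else {}) \<union> Suc ` ?S (y # z # zs)"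
    by blast
  moreover have "finite (?S (y # z # zs))"
    by (rule finite_subset[of _ "{..<length (y # z # zs)}"]) auto
  ultimately show ?thesis
    unfolding peak_def by (auto simp: card_image card_insert_if)
qed

lemma des_short [simp]: "des [] = 0" "des [x] = 0"
  by (simp_all add: des_def)

lemma peak_short [simp]: "peak [] = 0" "peak [x] = 0" "peak [x, y] = 0"
  by (auto simp: peak_def)

text \<open>Stepping up from \<open>L\<close> to \<open>n\<close> is never a descent, and stepping
  down from \<open>n\<close> into a nonempty \<open>R\<close> always is.\<close>

lemma des_max_split:
  assumes "\<forall>x \<in> set L \<union> set R. x < n"
  shows "des (L @ n # R) = des L + des R + of_bool (R \<noteq> [])"
  using assms
proof (induction L rule: induct_list012)
  case 1
  then show ?case by (cases R) (auto simp: des_Cons2)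
next
  case (2 x)
  then show ?case by (cases R) (auto simp: des_Cons2)
next
  case (3 x y zs)
  then show ?case by (simp add: des_Cons2)
qed

text \<open>The neighbours of \<open>n\<close> are peaks neither in the whole word, being below
  \<open>n\<close>, nor in their own part, being at its end. So only \<open>n\<close> can be a new
  peak, and it needs neighbours on both sides.\<close>

lemma peak_max_split:
  assumes "\<forall>x \<in> set L \<union> set R. x < n"
  shows "peak (L @ n # R) = peak L + peak R + of_bool (L \<noteq> [] \<and> R \<noteq> [])"
  using assms
proof (induction L rule: induct_list012)
  case 1
  then show ?case by (cases R; cases "tl R") (auto simp: peak_Cons3)
next
  case (2 x)
  then show ?case by (cases R; cases "tl R") (auto simp: peak_Cons3)
next
  case (3 x y zs)
  then show ?case by (cases zs; cases R) (auto simp: peak_Cons3)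
qed

lemma subseq_Cons_skip_prefix:
  assumes "x \<notin> set L"
  shows "subseq (x # ys) (L @ zs) \<longleftrightarrow> subseq (x # ys) zs"
  using assms by (induction L) auto

text \<open>A run starting with \<open>Suc n\<close> can go on with \<open>n\<close> only inside
  \<open>R\<close>. If \<open>n\<close> is there, it does not occur in \<open>L\<close>, so a run
  starting at \<open>n\<close> embeds in \<open>L @ R\<close> exactly if it embeds in
  \<open>R\<close>.\<close>

lemma zeil_max_split:
  assumes perm: "L @ R \<in> perms n"
  shows "zeil (L @ Suc n # R) = (if n \<in> set R then Suc (zeil (L @ R)) else 1)"
proof -
  note p = permsD[OF perm]
  have len: "length (L @ R) = n" by (rule p(3))
  have fresh: "Suc n \<notin> set L"
  proof
    assume "Suc n \<in> set L"
    then have "Suc n \<in> set (L @ R)" by simp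
    then show False unfolding p(1) by simp
  qed
  define Z where "Z m \<longleftrightarrow> subseq (rev [Suc n - m..<Suc n]) (L @ R)" for m
  define Z' where "Z' m \<longleftrightarrow> subseq (rev [Suc (Suc n) - m..<Suc (Suc n)]) (L @ Suc n # R)" for m
  \<comment> \<open>The run of length \<open>Suc m\<close> starts with \<open>Suc n\<close>, which
    does not occur in \<open>L\<close>; the rest must therefore embed in \<open>R\<close>.\<close>
  have Z'_Suc: "Z' (Suc m) \<longleftrightarrow> subseq (rev [Suc n - m..<Suc n]) R" if "m \<le> n" for m
  proof -
    have "rev [Suc (Suc n) - Suc m..<Suc (Suc n)] = Suc n # rev [Suc n - m..<Suc n]"
      using that by simp
    then show ?thesis
      unfolding Z'_def by (simp only: subseq_Cons_skip_prefix[OF fresh] subseq_Cons2_iff simp_thms if_True)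
  qed
  have zeil: "zeil (L @ R) = Max {m. m \<le> n \<and> Z m}"
    and zeil': "zeil (L @ Suc n # R) = Max {m. m \<le> Suc n \<and> Z' m}"
    using len unfolding zeil_def Z_def Z'_def by (simp_all del: upt_Suc)
  have "{m. m \<le> Suc n \<and> Z' m} = insert 0 (Suc ` {m. m \<le> n \<and> Z' (Suc m)})"
  proof (rule set_eqI)
    fix m show "m \<in> {m. m \<le> Suc n \<and> Z' m} \<longleftrightarrow> m \<in> insert 0 (Suc ` {m. m \<le> n \<and> Z' (Suc m)})"
      by (cases m) (auto simp: Z'_def)
  qed
  moreover have "Max (insert 0 (Suc ` M)) = Suc (Max M)" if "finite M" "0 \<in> M" for M
  proof -
    have "M \<noteq> {}" using that(2) by auto
    with that(1) show ?thesis
      using mono_Max_commute[of Suc M] by (simp add: mono_def)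
  qed
  moreover have "0 \<in> {m. m \<le> n \<and> Z' (Suc m)}"
    using Z'_Suc[of 0] by simp
  ultimately have *: "zeil (L @ Suc n # R) = Suc (Max {m. m \<le> n \<and> Z' (Suc m)})"
    unfolding zeil' by simp
  show ?thesis
  proof (cases "n \<in> set R")
    case True
    then have nL: "n \<notin> set L" using p(2) by auto
    have "Z' (Suc m) \<longleftrightarrow> Z m" if "m \<le> n" for m
    proof (cases m)
      case (Suc k)
      have "rev [Suc n - m..<Suc n] = n # rev [Suc n - m..<n]"
        using that Suc by simp
      then show ?thesis
        unfolding Z'_Suc[OF that] Z_def by (simp only: subseq_Cons_skip_prefix[OF nL])
    qed (simp add: Z'_Suc Z_def)
    then have "{m. m \<le> n \<and> Z' (Suc m)} = {m. m \<le> n \<and> Z m}"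
      by (intro Collect_cong conj_cong) auto
    then show ?thesis
      unfolding * zeil using True by simp
  next
    case False
    have "m = 0" if "m \<le> n" "Z' (Suc m)" for m
    proof (rule ccontr)
      assume "m \<noteq> 0"
      then have "n \<in> set (rev [Suc n - m..<Suc n])"
        using that(1) by auto
      with Z'_Suc[OF that(1)] that(2) have "n \<in> set R"
        by (blast elim: list_emb_set)
      with False show False ..
    qed
    moreover have "Z' (Suc 0)"
      using Z'_Suc[of 0] by simp
    ultimately have "{m. m \<le> n \<and> Z' (Suc m)} = {0}"
      by blast
    then show ?thesis
      unfolding * using False by simp
  qed
qed

section \<open>Forests\<close>

text \<open>A forest is listed from right to left, so that the word ending in the last entry of \<open>w\<close> is at
  the head.\<close>

definition forests :: "nat list \<Rightarrow> nat list list set" where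
  "forests w = {fs. [] \<notin> set fs \<and> concat (map stack_sort (rev fs)) = w}"

abbreviation sum_des :: "nat list list \<Rightarrow> nat" where
  "sum_des fs \<equiv> sum_list (map des fs)"

abbreviation sum_peak :: "nat list list \<Rightarrow> nat" where
  "sum_peak fs \<equiv> sum_list (map peak fs)"

text \<open>The number of words is recorded because it decides which flags are admissible in
  \<open>graft_dom\<close>, and because the forests with one word are the preimages under
  \<open>stack_sort\<close>.\<close>

definition fstat :: "nat list list \<Rightarrow> nat \<times> nat \<times> nat" where
  "fstat fs = (length fs, sum_des fs, sum_peak fs)"

text \<open>\<open>zeil\<close> is not additive over the words, so it is read off the whole forest,
  put back into left-to-right order.\<close>

definition fzeil :: "nat list list \<Rightarrow> nat" where
  "fzeil fs = zeil (concat (rev fs))"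

text \<open>In \<open>graft m (fs, l, r)\<close>, the flags tell whether the new maximum \<open>m\<close> absorbs a word on its left
  and on its right.\<close>

definition graft_dom :: "nat list \<Rightarrow> (nat list list \<times> bool \<times> bool) set" where
  "graft_dom w = {(fs, l, r). fs \<in> forests w \<and> of_bool l + of_bool r \<le> length fs}"

definition graft :: "nat \<Rightarrow> nat list list \<times> bool \<times> bool \<Rightarrow> nat list list" where
  "graft m = (\<lambda>(fs, l, r).
     let R = if r then hd fs else []; fs' = if r then tl fs else fs;
         L = if l then hd fs' else []; fs'' = if l then tl fs' else fs'
     in (L @ m # R) # fs'')"

text \<open>Inverse of \<open>graft\<close>, see \<open>graft_bij\<close>. The part \<open>R\<close>
  precedes \<open>L\<close> because forests are listed from right to left.\<close>

definition ungraft :: "nat \<Rightarrow> nat list list \<Rightarrow> nat list list \<times> bool \<times> bool" where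
  "ungraft m fs =
     (let L = takeWhile (\<lambda>x. x \<noteq> m) (hd fs); R = tl (dropWhile (\<lambda>x. x \<noteq> m) (hd fs))
      in ((if R = [] then [] else [R]) @ (if L = [] then [] else [L]) @ tl fs, L \<noteq> [], R \<noteq> []))"

lemma set_concat_forest:
  assumes "fs \<in> forests w"
  shows "\<Union> (set ` set fs) = set w"
  using assms by (auto simp: forests_def)

lemma mset_concat_forest:
  assumes "fs \<in> forests w"
  shows "mset (concat (rev fs)) = mset w"
proof -
  have "mset (concat (map stack_sort xs)) = mset (concat xs)" for xs
    by (induction xs) auto
  moreover have "concat (map stack_sort (rev fs)) = w"
    using assms by (simp add: forests_def)
  ultimately show ?thesis
    by metis
qed

lemma forest_perms:
  assumes "fs \<in> forests w" "w \<in> perms n"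
  shows "concat (rev fs) \<in> perms n"
proof -
  have m: "mset (concat (rev fs)) = mset w"
    by (rule mset_concat_forest[OF assms(1)])
  from mset_eq_setD[OF m] mset_eq_imp_distinct_iff[OF m] assms(2) show ?thesis
    by (simp add: permutations_of_set_def del: set_concat distinct_concat_iff)
qed

lemma forests_Nil [simp]: "forests [] = {[]}"
proof -
  have "fs \<in> forests [] \<Longrightarrow> fs = []" for fs
    by (cases fs) (auto simp: forests_def)
  then show ?thesis
    by (auto simp: forests_def)
qed

text \<open>Words of a forest are nonempty, so \<open>[]\<close> can stand for an absent part and
  the flags can be read off \<open>L\<close> and \<open>R\<close>. This puts the four flag
  combinations into one normal form.\<close>

lemma graft_dom_cases:
  assumes "d \<in> graft_dom w"
  obtains L R fs where "(if R = [] then [] else [R]) @ (if L = [] then [] else [L]) @ fs \<in> forests w"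
    and "d = ((if R = [] then [] else [R]) @ (if L = [] then [] else [L]) @ fs, L \<noteq> [], R \<noteq> [])"
    and "graft m d = (L @ m # R) # fs"
proof -
  obtain gs l r where d: "d = (gs, l, r)" by (cases d) auto
  define R where "R = (if r then hd gs else [])"
  define gs' where "gs' = (if r then tl gs else gs)"
  define L where "L = (if l then hd gs' else [])"
  define fs where "fs = (if l then tl gs' else gs')"
  have gs: "gs \<in> forests w" "of_bool l + of_bool r \<le> length gs"
    using assms d by (auto simp: graft_dom_def)
  then have ne: "[] \<notin> set gs"
    by (auto simp: forests_def)
  have 1: "(R \<noteq> []) = r" "gs = (if R = [] then [] else [R]) @ gs'"
    unfolding R_def gs'_def using gs(2) ne by (cases gs; auto)+
  with gs(2) ne have ne': "[] \<notin> set gs'" "of_bool l \<le> length gs'"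
    by (auto split: if_splits)
  have 2: "(L \<noteq> []) = l" "gs' = (if L = [] then [] else [L]) @ fs"
    unfolding L_def fs_def using ne' by (cases gs'; auto)+
  show thesis
  proof (rule that[of R L fs])
    show eq: "d = ((if R = [] then [] else [R]) @ (if L = [] then [] else [L]) @ fs, L \<noteq> [], R \<noteq> [])"
      using d 1 2 by simp
    then show "(if R = [] then [] else [R]) @ (if L = [] then [] else [L]) @ fs \<in> forests w"
      using gs(1) d by simp
    show "graft m d = (L @ m # R) # fs"
      unfolding d graft_def using R_def gs'_def L_def fs_def by (simp add: Let_def)
  qed
qed

text \<open>The word whose image ends in the maximum \<open>m\<close> is \<open>L @ m # R\<close>,
  with image \<open>stack_sort L @ stack_sort R @ [m]\<close>. Deleting \<open>m\<close> leaves a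
  forest for \<open>w\<close> in which \<open>L\<close> and \<open>R\<close>, when nonempty, are the
  last words; the flags remember which of them were there.\<close>

lemma graft_bij:
  assumes dist: "distinct w" and m: "\<forall>x \<in> set w. x < m"
  shows "bij_betw (graft m) (graft_dom w) (forests (w @ [m]))"
proof (rule bij_betw_byWitness[where f' = "ungraft m"])
  show "\<forall>d \<in> graft_dom w. ungraft m (graft m d) = d"
  proof
    fix d assume "d \<in> graft_dom w"
    then obtain L R fs where *: "(if R = [] then [] else [R]) @ (if L = [] then [] else [L]) @ fs \<in> forests w"
      "d = ((if R = [] then [] else [R]) @ (if L = [] then [] else [L]) @ fs, L \<noteq> [], R \<noteq> [])"
      "graft m d = (L @ m # R) # fs"
      by (rule graft_dom_cases[where m = m])
    have "m \<notin> set L"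
      using set_concat_forest[OF *(1)] m by (auto split: if_splits)
    then have "takeWhile (\<lambda>x. x \<noteq> m) (L @ m # R) = L" "dropWhile (\<lambda>x. x \<noteq> m) (L @ m # R) = m # R"
      by (auto simp: takeWhile_append dropWhile_append)
    then show "ungraft m (graft m d) = d"
      unfolding *(3) ungraft_def by (simp add: *(2) Let_def)
  qed
next
  have split: "\<exists>L R gs. fs = (L @ m # R) # gs \<and> m \<notin> set L \<and>
      (if R = [] then [] else [R]) @ (if L = [] then [] else [L]) @ gs \<in> forests w"
    if fs: "fs \<in> forests (w @ [m])" for fs
  proof -
    obtain t gs where tgs: "fs = t # gs"
      using fs by (cases fs) (auto simp: forests_def)
    have t: "t \<noteq> []" "concat (map stack_sort (rev gs)) @ stack_sort t = w @ [m]" "[] \<notin> set gs"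
      using fs tgs by (auto simp: forests_def)
    then have mt: "m \<in> set t"
      by (metis last_appendR last_in_set last_snoc set_stack_sort stack_sort_eq_Nil_iff)
    have sub: "set t \<subseteq> insert m (set w)"
      using arg_cong[OF t(2), of set] by auto
    have "distinct (concat (map stack_sort (rev gs)) @ stack_sort t)"
      unfolding t(2) using dist m by auto
    then have dt: "distinct t"
      by (simp del: distinct_concat_iff)
    obtain L R where LR: "t = L @ m # R" "\<forall>x \<in> set L \<union> set R. x < m"
      using max_last_decomp[OF dt mt] sub m by (metis insert_iff less_imp_le order_refl subset_iff)
    have "concat (map stack_sort (rev gs)) @ stack_sort L @ stack_sort R = w"
      using t(2) LR by (simp add: stack_sort_append)
    then show ?thesis
      using tgs LR t(3) by (intro exI[of _ L] exI[of _ R] exI[of _ gs])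
        (auto simp: forests_def stack_sort_Nil)
  qed
  show "\<forall>fs \<in> forests (w @ [m]). graft m (ungraft m fs) = fs"
  proof
    fix fs assume "fs \<in> forests (w @ [m])"
    from split[OF this] obtain L R gs where *: "fs = (L @ m # R) # gs" "m \<notin> set L" by blast
    then have "takeWhile (\<lambda>x. x \<noteq> m) (L @ m # R) = L" "dropWhile (\<lambda>x. x \<noteq> m) (L @ m # R) = m # R"
      by (auto simp: takeWhile_append dropWhile_append)
    with * show "graft m (ungraft m fs) = fs"
      by (auto simp: ungraft_def graft_def Let_def)
  qed
  show "ungraft m ` forests (w @ [m]) \<subseteq> graft_dom w"
  proof (rule image_subsetI)
    fix fs assume "fs \<in> forests (w @ [m])"
    from split[OF this] obtain L R gs where *: "fs = (L @ m # R) # gs" "m \<notin> set L"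
      "(if R = [] then [] else [R]) @ (if L = [] then [] else [L]) @ gs \<in> forests w" by blast
    then have "takeWhile (\<lambda>x. x \<noteq> m) (L @ m # R) = L" "dropWhile (\<lambda>x. x \<noteq> m) (L @ m # R) = m # R"
      by (auto simp: takeWhile_append dropWhile_append)
    with * show "ungraft m fs \<in> graft_dom w"
      by (auto simp: ungraft_def graft_dom_def Let_def)
  qed
  show "graft m ` graft_dom w \<subseteq> forests (w @ [m])"
  proof clarify
    fix a b c assume "(a, b, c) \<in> graft_dom w"
    then obtain L R fs where *: "(if R = [] then [] else [R]) @ (if L = [] then [] else [L]) @ fs \<in> forests w"
      "graft m (a, b, c) = (L @ m # R) # fs"
      by (rule graft_dom_cases[where m = m]) blast
    have "\<forall>x \<in> set L \<union> set R. x < m"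
      using set_concat_forest[OF *(1)] m by (auto split: if_splits)
    from stack_sort_append[OF this] *(1) show "graft m (a, b, c) \<in> forests (w @ [m])"
      unfolding *(2) by (auto simp: forests_def stack_sort_Nil split: if_splits)
  qed
qed

text \<open>The new word adds one to the number of words and each absorbed word takes one away. The
  subtraction does not truncate, by the bound in \<open>graft_dom\<close>.\<close>

lemma fstat_graft:
  assumes "(fs, l, r) \<in> graft_dom w" "\<forall>x \<in> set w. x < m"
  shows "fstat (graft m (fs, l, r)) =
    (Suc (length fs) - of_bool l - of_bool r, sum_des fs + of_bool r, sum_peak fs + of_bool (l \<and> r))"
proof -
  obtain L R gs where *: "(if R = [] then [] else [R]) @ (if L = [] then [] else [L]) @ gs \<in> forests w"
    "(fs, l, r) = ((if R = [] then [] else [R]) @ (if L = [] then [] else [L]) @ gs, L \<noteq> [], R \<noteq> [])"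
    "graft m (fs, l, r) = (L @ m # R) # gs"
    using assms(1) by (rule graft_dom_cases[where m = m]) blast
  have "\<forall>x \<in> set L \<union> set R. x < m"
    using set_concat_forest[OF *(1)] assms(2) by (auto split: if_splits)
  from des_max_split[OF this] peak_max_split[OF this] *(2) show ?thesis
    unfolding *(3) by (auto simp: fstat_def)
qed

text \<open>By \<open>zeil_max_split\<close> the question is whether \<open>n\<close> lies in the
  absorbed right part. The sorted right part is the end of \<open>w\<close> and has its maximum as
  last entry, so this means that \<open>w\<close> ends in \<open>n\<close>.\<close>

lemma fzeil_graft:
  assumes d: "(fs, l, r) \<in> graft_dom w" and w: "w \<in> perms n"
  shows "fzeil (graft (Suc n) (fs, l, r)) =
    (if r \<and> last w = n then Suc (fzeil fs) else 1)"
proof -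
  obtain L R gs where *: "(if R = [] then [] else [R]) @ (if L = [] then [] else [L]) @ gs \<in> forests w"
    "(fs, l, r) = ((if R = [] then [] else [R]) @ (if L = [] then [] else [L]) @ gs, L \<noteq> [], R \<noteq> [])"
    "graft (Suc n) (fs, l, r) = (L @ Suc n # R) # gs"
    using d by (rule graft_dom_cases[where m = "Suc n"]) blast
  have fs: "fs \<in> forests w" and r: "r = (R \<noteq> [])" and LR: "concat (rev fs) = (concat (rev gs) @ L) @ R"
    using * by auto
  have "n \<in> set R \<longleftrightarrow> r \<and> last w = n"
  proof (cases "R = []")
    case False
    then have w_eq: "w = concat (map stack_sort (rev gs)) @ stack_sort L @ stack_sort R"
      using *(1) by (auto simp: forests_def stack_sort_Nil split: if_splits)
    then have "last w = Max (set R)"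
      using False by (simp add: last_stack_sort)
    moreover have "n \<in> set R \<longleftrightarrow> Max (set R) = n"
    proof
      assume "n \<in> set R"
      moreover have "set R \<subseteq> {1..n}"
        using w_eq permsD(1)[OF w] by auto
      ultimately show "Max (set R) = n"
        by (intro Max_eqI) auto
    next
      assume "Max (set R) = n"
      with False show "n \<in> set R"
        by (metis List.finite_set Max_in set_empty)
    qed
    ultimately show ?thesis
      using r False by simp
  qed (simp add: r)
  with zeil_max_split[of "concat (rev gs) @ L" R n] forest_perms[OF fs w] LR show ?thesis
    unfolding *(3) by (simp add: fzeil_def)
qed

section \<open>Equidistribution of forests and its closure properties\<close>

definition forest_equiv :: "nat list \<Rightarrow> nat list \<Rightarrow> bool" where
  "forest_equiv w w' \<longleftrightarrow>
     (\<exists>f. bij_betw f (forests w) (forests w') \<and> (\<forall>fs \<in> forests w. fstat (f fs) = fstat fs))"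

text \<open>Kept apart from \<open>forest_equiv\<close>, since \<open>fzeil_graft\<close> needs
  permutations of \<open>{1..n}\<close>, whereas the blocks of a swing have arbitrary
  entries.\<close>

definition forest_zeil_equiv :: "nat list \<Rightarrow> nat list \<Rightarrow> bool" where
  "forest_zeil_equiv w w' \<longleftrightarrow>
     (\<exists>f. bij_betw f (forests w) (forests w') \<and>
        (\<forall>fs \<in> forests w. fstat (f fs) = fstat fs \<and> fzeil (f fs) = fzeil fs))"

text \<open>The admissible flags depend only on the number of words, and \<open>fstat_graft\<close>
  only on \<open>fstat\<close> and the flags. So it suffices to apply \<open>f\<close> to the
  smaller forest and keep the flags; this description of \<open>g\<close> is exported for following
  \<open>fzeil\<close>. The maxima \<open>m\<close> and \<open>m'\<close> may differ.\<close>

lemma graft_transfer: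
  assumes dist: "distinct w" "distinct w'"
    and m: "\<forall>x \<in> set w. x < m" "\<forall>x \<in> set w'. x < m'"
    and f: "bij_betw f (forests w) (forests w')" "\<forall>fs \<in> forests w. fstat (f fs) = fstat fs"
  obtains g where "bij_betw g (forests (w @ [m])) (forests (w' @ [m']))"
    and "\<And>fs l r. (fs, l, r) \<in> graft_dom w \<Longrightarrow> (f fs, l, r) \<in> graft_dom w' \<and>
           g (graft m (fs, l, r)) = graft m' (f fs, l, r)"
    and "\<And>gs. gs \<in> forests (w @ [m]) \<Longrightarrow> fstat (g gs) = fstat gs"
proof -
  define F where "F = (\<lambda>(fs :: nat list list, l :: bool, r :: bool). (f fs, l, r))"
  have len: "length (f fs) = length fs" "sum_des (f fs) = sum_des fs" "sum_peak (f fs) = sum_peak fs"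
    if "fs \<in> forests w" for fs
    using f(2) that by (auto simp: fstat_def)
  have F: "bij_betw F (graft_dom w) (graft_dom w')"
  proof (rule bij_betw_imageI)
    show "inj_on F (graft_dom w)"
      using bij_betw_imp_inj_on[OF f(1)] by (auto simp: inj_on_def F_def graft_dom_def)
    have "(gs, l, r) \<in> F ` graft_dom w" if "(gs, l, r) \<in> graft_dom w'" for gs l r
    proof -
      have "gs \<in> f ` forests w"
        using that bij_betw_imp_surj_on[OF f(1)] by (simp add: graft_dom_def)
      then obtain fs where "fs \<in> forests w" "gs = f fs"
        by blast
      with that len(1) show ?thesis
        by (intro image_eqI[of _ _ "(fs, l, r)"]) (auto simp: F_def graft_dom_def)
    qed
    moreover have "F d \<in> graft_dom w'" if "d \<in> graft_dom w" for d
      using that bij_betwE[OF f(1)] len(1) by (auto simp: F_def graft_dom_def)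
    ultimately show "F ` graft_dom w = graft_dom w'"
      by auto
  qed
  note b = graft_bij[OF dist(1) m(1)] and b' = graft_bij[OF dist(2) m(2)]
  define g where "g = graft m' \<circ> F \<circ> inv_into (graft_dom w) (graft m)"
  have g: "g (graft m (fs, l, r)) = graft m' (f fs, l, r)" and Fd: "(f fs, l, r) \<in> graft_dom w'"
    if "(fs, l, r) \<in> graft_dom w" for fs l r
    using that bij_betw_inv_into_left[OF b that] bij_betwE[OF F] by (force simp: g_def F_def)+
  show thesis
  proof (rule that[of g])
    show "bij_betw g (forests (w @ [m])) (forests (w' @ [m']))"
      unfolding g_def by (intro bij_betw_trans[OF bij_betw_inv_into[OF b]] bij_betw_trans[OF F b'])
    show "(f fs, l, r) \<in> graft_dom w' \<and> g (graft m (fs, l, r)) = graft m' (f fs, l, r)"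
      if "(fs, l, r) \<in> graft_dom w" for fs l r
      using g Fd that by blast
    fix gs assume "gs \<in> forests (w @ [m])"
    then obtain fs l r where d: "(fs, l, r) \<in> graft_dom w" "gs = graft m (fs, l, r)"
      using bij_betw_imp_surj_on[OF b] by (metis imageE prod_cases3)
    then have "fs \<in> forests w"
      by (simp add: graft_dom_def)
    with len show "fstat (g gs) = fstat gs"
      unfolding d(2) g[OF d(1)] fstat_graft[OF d(1) m(1)] fstat_graft[OF Fd[OF d(1)] m(2)] by simp
  qed
qed

lemma forest_equiv_snoc_max:
  assumes "forest_equiv w w'" "distinct w" "distinct w'"
    and "\<forall>x \<in> set w. x < m" "\<forall>x \<in> set w'. x < m'"
  shows "forest_equiv (w @ [m]) (w' @ [m'])"
  using assms unfolding forest_equiv_def by (metis graft_transfer)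

text \<open>By \<open>fzeil_graft\<close> the value for a grafted forest refers back to
  \<open>fzeil\<close> only if the word ends in \<open>n\<close>; otherwise it is always 1, and
  equidistribution of \<open>fstat\<close> suffices.\<close>

lemma forest_zeil_equiv_snoc_max:
  assumes w: "w \<in> perms n" "w' \<in> perms n"
    and last: "last w = n \<longleftrightarrow> last w' = n"
    and equiv: "if last w = n then forest_zeil_equiv w w' else forest_equiv w w'"
  shows "forest_zeil_equiv (w @ [Suc n]) (w' @ [Suc n])"
proof -
  note p = permsD[OF w(1)] and p' = permsD[OF w(2)]
  obtain f where f: "bij_betw f (forests w) (forests w')" "\<forall>fs \<in> forests w. fstat (f fs) = fstat fs"
    and z: "last w = n \<Longrightarrow> \<forall>fs \<in> forests w. fzeil (f fs) = fzeil fs"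
    using equiv unfolding forest_zeil_equiv_def forest_equiv_def by (auto split: if_splits)
  have m: "\<forall>x \<in> set w. x < Suc n" "\<forall>x \<in> set w'. x < Suc n"
    using p p' by auto
  obtain g where g: "bij_betw g (forests (w @ [Suc n])) (forests (w' @ [Suc n]))"
    "\<And>fs l r. (fs, l, r) \<in> graft_dom w \<Longrightarrow> (f fs, l, r) \<in> graft_dom w' \<and>
           g (graft (Suc n) (fs, l, r)) = graft (Suc n) (f fs, l, r)"
    "\<And>gs. gs \<in> forests (w @ [Suc n]) \<Longrightarrow> fstat (g gs) = fstat gs"
    using graft_transfer[OF p(2) p'(2) m f] by metis
  have "fzeil (g gs) = fzeil gs" if gs: "gs \<in> forests (w @ [Suc n])" for gs
  proof -
    obtain fs l r where d: "(fs, l, r) \<in> graft_dom w" "gs = graft (Suc n) (fs, l, r)"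
      using bij_betw_imp_surj_on[OF graft_bij[OF p(2) m(1)]] gs by (metis imageE prod_cases3)
    then have "fs \<in> forests w"
      by (simp add: graft_dom_def)
    then have "fzeil (graft (Suc n) (f fs, l, r)) = fzeil (graft (Suc n) (fs, l, r))"
      unfolding fzeil_graft[OF d(1) w(1)] fzeil_graft[OF conjunct1[OF g(2)[OF d(1)]] w(2)]
      using last z by auto
    then show ?thesis
      using g(2)[OF d(1)] d(2) by simp
  qed
  with g show ?thesis
    unfolding forest_zeil_equiv_def by blast
qed

text \<open>A sorted word ends in its maximum. If the word ending in \<open>p\<close> had another
  entry, it would contain \<open>last w\<close>, which exceeds \<open>p\<close>.\<close>

lemma forests_snoc_less:
  assumes w: "w \<noteq> []" "p < last w"
  shows "forests (w @ [p]) = (\<lambda>fs. [p] # fs) ` forests w"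
proof
  show "(\<lambda>fs. [p] # fs) ` forests w \<subseteq> forests (w @ [p])"
    by (auto simp: forests_def stack_sort_singleton)
  show "forests (w @ [p]) \<subseteq> (\<lambda>fs. [p] # fs) ` forests w"
  proof
    fix fs assume fs: "fs \<in> forests (w @ [p])"
    then obtain t gs where tgs: "fs = t # gs"
      by (cases fs) (auto simp: forests_def)
    have t: "t \<noteq> []" "concat (map stack_sort (rev gs)) @ stack_sort t = w @ [p]" "[] \<notin> set gs"
      using fs tgs by (auto simp: forests_def)
    have max: "Max (set t) = p"
      using t by (metis last_appendR last_snoc last_stack_sort stack_sort_eq_Nil_iff)
    have snoc: "stack_sort t = butlast (stack_sort t) @ [p]"
      using t(1) last_stack_sort[OF t(1)] max by (metis append_butlast_last_id stack_sort_eq_Nil_iff)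
    have "butlast (stack_sort t) = []"
    proof (rule ccontr)
      assume ne: "butlast (stack_sort t) \<noteq> []"
      have "concat (map stack_sort (rev gs)) @ butlast (stack_sort t) = w"
        using t(2) snoc by (metis append.assoc append1_eq_conv)
      then have "last w = last (butlast (stack_sort t))"
        using ne by auto
      then have "last w \<in> set t"
        using ne by (metis in_set_butlastD last_in_set set_stack_sort)
      with max w(2) show False
        by (metis List.finite_set Max_ge not_less)
    qed
    with snoc have "t = [p]"
      by simp
    with t tgs show "fs \<in> (\<lambda>fs. [p] # fs) ` forests w"
      by (auto simp: forests_def stack_sort_singleton)
  qed
qed

text \<open>The sorted first word starts with \<open>a\<close>, which is its maximum and hence also
  its last entry; since \<open>a\<close> does not occur in \<open>w\<close>, nothing else fits
  in.\<close>

lemma forests_Cons_greater: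
  assumes a: "\<forall>x \<in> set w. x < a"
  shows "forests (a # w) = (\<lambda>fs. fs @ [[a]]) ` forests w"
proof
  show "(\<lambda>fs. fs @ [[a]]) ` forests w \<subseteq> forests (a # w)"
    by (auto simp: forests_def stack_sort_singleton)
  show "forests (a # w) \<subseteq> (\<lambda>fs. fs @ [[a]]) ` forests w"
  proof
    fix fs assume fs: "fs \<in> forests (a # w)"
    then obtain t gs where tgs: "fs = gs @ [t]"
      by (cases fs rule: rev_cases) (auto simp: forests_def)
    have t: "t \<noteq> []" "stack_sort t @ concat (map stack_sort (rev gs)) = a # w" "[] \<notin> set gs"
      using fs tgs by (auto simp: forests_def)
    obtain u where u: "stack_sort t = a # u" "u @ concat (map stack_sort (rev gs)) = w"
      using t(1,2) by (auto simp: append_eq_Cons_conv)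
    have st: "set t = insert a (set u)"
      using arg_cong[OF u(1), of set] by simp
    have "Max (set t) = a"
      using u(2) a by (simp add: st) (intro Max_eqI, auto intro: less_imp_le)
    then have "last (a # u) = a"
      using last_stack_sort[OF t(1)] u(1) by simp
    then have "u = []"
      using last_in_set[of u] u(2) a by (auto split: if_splits)
    with u t tgs show "fs \<in> (\<lambda>fs. fs @ [[a]]) ` forests w"
      by (auto simp: forests_def)
  qed
qed

text \<open>The two sides may be changed by different operations as long as both have the same
  effect \<open>h\<close> on \<open>fstat\<close>.\<close>

lemma forest_equiv_transport:
  assumes "forest_equiv w w'" "bij_betw g (forests w) (forests v)" "bij_betw g' (forests w') (forests v')"
    and g: "\<And>fs. fstat (g fs) = h (fstat fs)" "\<And>fs. fstat (g' fs) = h (fstat fs)"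
  shows "forest_equiv v v'"
proof -
  obtain f where f: "bij_betw f (forests w) (forests w')" "\<forall>fs \<in> forests w. fstat (f fs) = fstat fs"
    using assms(1) unfolding forest_equiv_def by blast
  let ?i = "inv_into (forests w) g"
  have "bij_betw (g' \<circ> (f \<circ> ?i)) (forests v) (forests v')"
    by (intro bij_betw_trans[OF bij_betw_trans[OF bij_betw_inv_into[OF assms(2)] f(1)] assms(3)])
  moreover have "fstat (g' (f (?i fs))) = fstat fs" if "fs \<in> forests v" for fs
  proof -
    have i: "?i fs \<in> forests w" "g (?i fs) = fs"
      using that assms(2) by (auto simp: bij_betw_def inv_into_into f_inv_into_f)
    then show ?thesis
      using f(2) g by metis
  qed
  ultimately show ?thesis
    unfolding forest_equiv_def by (metis comp_apply)
qed

lemma fstat_single [simp]: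
  "fstat ([a] # fs) = (case fstat fs of (j, x) \<Rightarrow> (Suc j, x))"
  "fstat (fs @ [[a]]) = (case fstat fs of (j, x) \<Rightarrow> (Suc j, x))"
  by (simp_all add: fstat_def)

lemma forest_equiv_snoc_less:
  assumes "forest_equiv w w'" "w \<noteq> []" "p < last w" "w' \<noteq> []" "p' < last w'"
  shows "forest_equiv (w @ [p]) (w' @ [p'])"
  by (rule forest_equiv_transport[OF assms(1), where g = "\<lambda>fs. [p] # fs" and g' = "\<lambda>fs. [p'] # fs"])
    (auto simp: forests_snoc_less[OF assms(2,3)] forests_snoc_less[OF assms(4,5)]
      bij_betw_def inj_on_def)

text \<open>A dominating first entry and a last entry below its predecessor both contribute one
  extra word of length one, so they can be traded for each other.\<close>

lemma forest_equiv_Cons_snoc: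
  assumes "forest_equiv w w'" "\<forall>x \<in> set w. x < a" "w' \<noteq> []" "p < last w'"
  shows "forest_equiv (a # w) (w' @ [p])"
  by (rule forest_equiv_transport[OF assms(1), where g = "\<lambda>fs. fs @ [[a]]" and g' = "\<lambda>fs. [p] # fs"])
    (auto simp: forests_Cons_greater[OF assms(2)] forests_snoc_less[OF assms(3,4)]
      bij_betw_def inj_on_def)

section \<open>Swinging\<close>

text \<open>On permutations, \<open>swing w w'\<close> says that \<open>w\<close> avoids 132 and 3412 and that \<open>w'\<close> is \<open>swl w\<close>.\<close>

inductive swing :: "nat list \<Rightarrow> nat list \<Rightarrow> bool" where
  Nil: "swing [] []"
| snoc: "swing A A' \<Longrightarrow> swing B B' \<Longrightarrow> \<forall>a \<in> set A. p < a \<Longrightarrow> \<forall>b \<in> set B. b < p \<Longrightarrow>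
     B = [] \<or> sorted_wrt (>) A \<Longrightarrow> swing (A @ B @ [p]) (B' @ A' @ [p])"

lemma set_swing: "swing w w' \<Longrightarrow> set w' = set w"
  by (induction rule: swing.induct) auto

lemma swing_Nil_iff: "swing w w' \<Longrightarrow> w = [] \<longleftrightarrow> w' = []"
  using set_swing[of w w'] by auto

lemma last_swing: "swing w w' \<Longrightarrow> last w' = last w"
  by (induction rule: swing.induct) auto

lemma distinct_swing: "swing w w' \<Longrightarrow> distinct w \<and> distinct w'"
proof (induction rule: swing.induct)
  case (snoc A A' B B' p)
  have "set A \<inter> set B = {}" "p \<notin> set A" "p \<notin> set B"
    using snoc.hyps(3,4) by (blast dest: less_trans less_irrefl[THEN notE])+
  with snoc.IH set_swing[OF snoc.hyps(1)] set_swing[OF snoc.hyps(2)] show ?case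
    by auto
qed simp

lemma swing_perms:
  assumes "swing w w'"
  shows "w \<in> perms n \<longleftrightarrow> w' \<in> perms n"
  using set_swing[OF assms] distinct_swing[OF assms] by (simp add: permutations_of_set_def)

text \<open>An entry of \<open>B\<close> precedes \<open>p\<close> in both words and lies below it,
  so a decreasing word has \<open>B\<close> empty. For the rule \<open>snoc\<close> with nonempty
  \<open>B\<close> this gives \<open>A' = A\<close>.\<close>

lemma swing_sorted:
  assumes "swing w w'" "sorted_wrt (>) w \<or> sorted_wrt (>) w'"
  shows "w' = w"
  using assms
proof (induction rule: swing.induct)
  case (snoc A A' B B' p)
  note sets = set_swing[OF snoc.hyps(1)] set_swing[OF snoc.hyps(2)]
  have "B = []"
  proof (rule ccontr)
    assume "B \<noteq> []"
    then obtain b where b: "b \<in> set B" by (cases B) auto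
    with snoc.prems sets have "p < b"
      by (auto simp: sorted_wrt_append)
    with snoc.hyps(4) b show False by force
  qed
  moreover from this have "B' = []"
    using sets by simp
  ultimately show ?case
    using snoc.IH(1) snoc.prems by (auto simp: sorted_wrt_append)
qed simp

text \<open>The last entry \<open>p\<close> is common to both derivations, and filtering by it
  recovers the blocks, so the rule \<open>snoc\<close> can be inverted in only one way.\<close>

lemma swing_unique: "swing w w1 \<Longrightarrow> swing w w2 \<Longrightarrow> w1 = w2"
proof (induction arbitrary: w2 rule: swing.induct)
  case Nil
  then show ?case
    using swing_Nil_iff by blast
next
  case (snoc A A' B B' p)
  from snoc.prems show ?case
  proof (cases rule: swing.cases)
    case (snoc A2 A2' B2 B2' p2)
    have p: "p2 = p" and eq: "A @ B = A2 @ B2"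
      using snoc(1) by (metis append.assoc append1_eq_conv)+
    have "filter (\<lambda>x. p < x) (A @ B) = A" "filter (\<lambda>x. x < p) (A @ B) = B"
      using snoc.hyps by (auto simp: filter_id_conv filter_empty_conv)
    moreover have "filter (\<lambda>x. p < x) (A2 @ B2) = A2" "filter (\<lambda>x. x < p) (A2 @ B2) = B2"
      using snoc(5,6) p by (auto simp: filter_id_conv filter_empty_conv)
    ultimately have "A2 = A" "B2 = B"
      using eq by simp_all
    then show ?thesis
      using snoc(2-4) p \<open>\<And>w. swing A w \<Longrightarrow> A' = w\<close> \<open>\<And>w. swing B w \<Longrightarrow> B' = w\<close> by simp
  qed simp
qed

lemma swing_unique_left: "swing w1 w \<Longrightarrow> swing w2 w \<Longrightarrow> w1 = w2"
proof (induction arbitrary: w2 rule: swing.induct)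
  case Nil
  then show ?case
    using swing_Nil_iff by blast
next
  case (snoc A A' B B' p)
  note sets = set_swing[OF snoc.hyps(1)] set_swing[OF snoc.hyps(2)]
  from snoc.prems show ?case
  proof (cases rule: swing.cases)
    case (snoc A2 A2' B2 B2' p2)
    note sets2 = set_swing[OF snoc(3)] set_swing[OF snoc(4)]
    have p: "p2 = p" and eq: "B' @ A' = B2' @ A2'"
      using snoc(2) by (metis append.assoc append1_eq_conv)+
    have "filter (\<lambda>x. p < x) (B' @ A') = A'" "filter (\<lambda>x. x < p) (B' @ A') = B'"
      using snoc.hyps sets by (auto simp: filter_id_conv filter_empty_conv)
    moreover have "filter (\<lambda>x. p < x) (B2' @ A2') = A2'" "filter (\<lambda>x. x < p) (B2' @ A2') = B2'"
      using snoc(5,6) p sets2 by (auto simp: filter_id_conv filter_empty_conv)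
    ultimately have "A2' = A'" "B2' = B'"
      using eq by simp_all
    then show ?thesis
      using snoc(1,3,4) p \<open>\<And>w. swing w A' \<Longrightarrow> A = w\<close> \<open>\<And>w. swing w B' \<Longrightarrow> B = w\<close> by simp
  qed simp
qed

section \<open>Swinging preserves the distribution on forests\<close>

text \<open>The first entry of \<open>D\<close> and the last entry of \<open>C\<close> are removed
  together by \<open>forest_equiv_Cons_snoc\<close>, each being a word by itself. Only the lengths
  of \<open>D\<close> and \<open>C\<close> have to agree, not their values.\<close>

lemma forest_equiv_prepend_append_decreasing:
  assumes "forest_equiv V W" "W \<noteq> []" "length D = length C"
    and "sorted_wrt (>) D" "\<forall>d \<in> set D. \<forall>v \<in> set V. v < d" "sorted_wrt (>) (last W # C)"
  shows "forest_equiv (D @ V) (W @ C)"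
  using assms
proof (induction D arbitrary: C)
  case (Cons d D)
  then obtain C' c where C: "C = C' @ [c]"
    by (cases C rule: rev_cases) auto
  have "forest_equiv (d # (D @ V)) ((W @ C') @ [c])"
  proof (rule forest_equiv_Cons_snoc)
    show "forest_equiv (D @ V) (W @ C')"
      using Cons.prems C by (intro Cons.IH) (auto simp: sorted_wrt_append)
    show "c < last (W @ C')"
      using Cons.prems C by (auto simp: sorted_wrt_append last_append)
  qed (use Cons.prems C in auto)
  then show ?case
    by (simp add: C)
qed simp

text \<open>If \<open>A\<close> is empty, \<open>p\<close> is a new maximum on both sides; if only
  \<open>B\<close> is empty, \<open>p\<close> is smaller than its predecessor. The blocks really
  change places only in the remaining case, and there \<open>A\<close> is decreasing.\<close>

lemma swing_forest_equiv: "swing w w' \<Longrightarrow> forest_equiv w w'"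
proof (induction rule: swing.induct)
  case Nil
  show ?case
    unfolding forest_equiv_def by (rule exI[of _ id]) simp
next
  case (snoc A A' B B' p)
  note sets = set_swing[OF snoc.hyps(1)] set_swing[OF snoc.hyps(2)]
  have dist: "distinct (A @ B @ [p])" "distinct (B' @ A' @ [p])"
    using distinct_swing[OF swing.snoc[OF snoc.hyps]] by blast+
  show ?case
  proof (cases "A = [] \<or> B = []")
    case True
    then show ?thesis
    proof
      assume "A = []"
      with sets have "A' = []" by simp
      with \<open>A = []\<close> dist snoc.hyps(4) sets forest_equiv_snoc_max[OF snoc.IH(2), of p p] show ?thesis
        by simp
    next
      assume B: "B = []"
      with sets have B': "B' = []" by simp
      show ?thesis
      proof (cases "A = []")
        case False
        then have A: "A \<noteq> []" "A' \<noteq> []" "p < last A" "p < last A'"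
          using swing_Nil_iff[OF snoc.hyps(1)] snoc.hyps(3) last_swing[OF snoc.hyps(1)] by auto
        with B B' forest_equiv_snoc_less[OF snoc.IH(1), of p p] show ?thesis
          by simp
      next
        case True
        with sets B B' show ?thesis
          unfolding forest_equiv_def by (intro exI[of _ id]) simp
      qed
    qed
  next
    case False
    with snoc.hyps have A: "sorted_wrt (>) A" "A' = A"
      using swing_sorted by blast+
    obtain a C where aC: "A = a # C"
      using False by (cases A) auto
    \<comment> \<open>On the left, \<open>p\<close> is the maximum after \<open>B\<close> and the
      entries of \<open>A\<close> stand alone in front. On the right, \<open>a\<close> takes the
      role of the maximum after \<open>B'\<close>, and \<open>C @ [p]\<close> is a decreasing tail
      with as many entries as \<open>A\<close>.\<close>
    have "forest_equiv (A @ (B @ [p])) ((B' @ [a]) @ (C @ [p]))"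
    proof (rule forest_equiv_prepend_append_decreasing)
      show "forest_equiv (B @ [p]) (B' @ [a])"
        using snoc.hyps(3,4) snoc.IH(2) sets aC dist
        by (intro forest_equiv_snoc_max) (auto intro: less_trans)
      show "sorted_wrt (>) (last (B' @ [a]) # C @ [p])"
        using A(1) aC snoc.hyps(3) by (auto simp: sorted_wrt_append)
      show "\<forall>d \<in> set A. \<forall>v \<in> set (B @ [p]). v < d"
        using snoc.hyps(3,4) by (auto intro: less_trans)
    qed (use aC dist A in auto)
    then show ?thesis
      by (simp add: A(2) aC)
  qed
qed

text \<open>Ending in the maximum forces \<open>A\<close> to be empty, so the swing acts on
  \<open>B\<close> alone. If \<open>B\<close> again ends in its maximum, the induction continues;
  otherwise \<open>swing_forest_equiv\<close> is enough. The alternative \<open>n = 0\<close> covers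
  the empty word, which has no last entry.\<close>

lemma swing_forest_zeil_equiv:
  assumes "swing w w'" "w \<in> perms n" "n = 0 \<or> last w = n"
  shows "forest_zeil_equiv w w'"
  using assms
proof (induction n arbitrary: w w')
  case 0
  then have "w = []" "w' = []"
    using swing_Nil_iff by (auto simp: permutations_of_set_def)
  then show ?case
    unfolding forest_zeil_equiv_def by (intro exI[of _ id]) simp
next
  case (Suc n)
  from Suc.prems(1) show ?case
  proof (cases rule: swing.cases)
    case Nil
    with Suc.prems(2) show ?thesis
      by (auto simp: permutations_of_set_def)
  next
    case (snoc A A' B B' p)
    note p = permsD[OF Suc.prems(2)]
    have [simp]: "p = Suc n"
      using Suc.prems(3) snoc(1) by simp
    have "A = []"
    proof (rule ccontr)
      assume "A \<noteq> []"
      then have "hd A \<in> set w" "p < hd A"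
        using snoc(1,5) by auto
      then show False
        unfolding p(1) by simp
    qed
    with snoc have w: "w = B @ [Suc n]" "w' = B' @ [Suc n]"
      using swing_Nil_iff[OF snoc(3)] by auto
    have B: "B \<in> perms n"
    proof -
      have "set B = {1..Suc n} - {Suc n}"
        using p(1,2) w by auto
      also have "\<dots> = {1..n}" by auto
      finally show ?thesis
        using p(2) w by (simp add: permutations_of_set_def)
    qed
    then have B': "B' \<in> perms n"
      using swing_perms[OF snoc(4)] by simp
    show ?thesis
      unfolding w
    proof (rule forest_zeil_equiv_snoc_max[OF B B'])
      show "last B = n \<longleftrightarrow> last B' = n"
        using last_swing[OF snoc(4)] by simp
      show "if last B = n then forest_zeil_equiv B B' else forest_equiv B B'"
        using Suc.IH[OF snoc(4) B] swing_forest_equiv[OF snoc(4)] by simp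
    qed
  qed
qed

lemma last_stack_sort_perms:
  assumes "stack_sort \<sigma> \<in> perms n" "n \<noteq> 0"
  shows "last (stack_sort \<sigma>) = n"
proof -
  have s: "set \<sigma> = {1..n}"
    using permsD(1)[OF assms(1)] by (simp only: set_stack_sort)
  with assms(2) have "\<sigma> \<noteq> []"
    by (metis atLeastAtMost_iff empty_iff empty_set le_refl less_one not_less)
  then have "last (stack_sort \<sigma>) = Max {1..n}"
    using last_stack_sort s by metis
  also have "\<dots> = n"
    using assms(2) by (intro Max_eqI) auto
  finally show ?thesis .
qed

text \<open>The forests with a single word are exactly the preimages under
  \<open>stack_sort\<close>, and a bijection of forests that preserves the number of words restricts
  to them.\<close>

lemma swing_fiber_bij:
  assumes sw: "swing \<pi> \<pi>'" and perm: "\<pi> \<in> perms n"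
  shows "\<exists>g. bij_betw g {\<sigma>. stack_sort \<sigma> = \<pi>} {\<sigma>. stack_sort \<sigma> = \<pi>'} \<and>
    (\<forall>\<sigma>. stack_sort \<sigma> = \<pi> \<longrightarrow> des (g \<sigma>) = des \<sigma> \<and> peak (g \<sigma>) = peak \<sigma> \<and> zeil (g \<sigma>) = zeil \<sigma>)"
proof -
  have perm': "\<pi>' \<in> perms n"
    using swing_perms[OF sw] perm by simp
  consider "n = 0" | "n \<noteq> 0" "last \<pi> \<noteq> n" | "n \<noteq> 0" "last \<pi> = n"
    by blast
  then show ?thesis
  proof cases
    case 1
    with perm perm' have "\<pi>' = \<pi>"
      by (simp add: permutations_of_set_def)
    then show ?thesis
      by (intro exI[of _ id]) simp
  next
    case 2
    \<comment> \<open>A sorted word ends in its maximum, so both fibers are empty.\<close>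
    then have "{\<sigma>. stack_sort \<sigma> = \<pi>} = {}" "{\<sigma>. stack_sort \<sigma> = \<pi>'} = {}"
      using last_stack_sort_perms perm perm' last_swing[OF sw] by auto
    then show ?thesis
      by (simp add: bij_betw_def)
  next
    case 3
    then have "forest_zeil_equiv \<pi> \<pi>'"
      using swing_forest_zeil_equiv[OF sw perm] by simp
    then obtain f where f: "bij_betw f (forests \<pi>) (forests \<pi>')"
      and st: "\<forall>fs \<in> forests \<pi>. fstat (f fs) = fstat fs \<and> fzeil (f fs) = fzeil fs"
      unfolding forest_zeil_equiv_def by blast
    have "\<pi> \<noteq> []"
      using 3 permsD(3)[OF perm] by auto
    then have ne: "\<pi> \<noteq> []" "\<pi>' \<noteq> []"
      using swing_Nil_iff[OF sw] by auto
    have single: "[\<sigma>] \<in> forests \<rho> \<longleftrightarrow> stack_sort \<sigma> = \<rho>" if "\<rho> \<noteq> []" for \<sigma> \<rho>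
      using that by (auto simp: forests_def stack_sort_Nil)
    define g where "g \<sigma> = hd (f [\<sigma>])" for \<sigma>
    have g: "f [\<sigma>] = [g \<sigma>]" "stack_sort (g \<sigma>) = \<pi>'" if "stack_sort \<sigma> = \<pi>" for \<sigma>
    proof -
      have \<sigma>: "[\<sigma>] \<in> forests \<pi>"
        using that single ne by blast
      then have "length (f [\<sigma>]) = 1"
        using st by (auto simp: fstat_def)
      then show *: "f [\<sigma>] = [g \<sigma>]"
        by (auto simp: g_def length_Suc_conv)
      have "f [\<sigma>] \<in> forests \<pi>'"
        using bij_betwE[OF f] \<sigma> by blast
      then show "stack_sort (g \<sigma>) = \<pi>'"
        unfolding * using single ne by blast
    qed
    have "bij_betw g {\<sigma>. stack_sort \<sigma> = \<pi>} {\<sigma>. stack_sort \<sigma> = \<pi>'}"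
    proof (rule bij_betw_imageI)
      show "inj_on g {\<sigma>. stack_sort \<sigma> = \<pi>}"
      proof (rule inj_onI, clarify)
        fix \<sigma> \<rho> assume *: "stack_sort \<rho> = stack_sort \<sigma>" "\<pi> = stack_sort \<sigma>" "g \<sigma> = g \<rho>"
        then have "f [\<sigma>] = f [\<rho>]"
          using g(1) by metis
        then have "[\<sigma>] = [\<rho>]"
          using bij_betw_imp_inj_on[OF f] single[OF ne(1)] * by (auto dest: inj_onD)
        then show "\<sigma> = \<rho>" by simp
      qed
      have "\<rho> \<in> g ` {\<sigma>. stack_sort \<sigma> = \<pi>}" if "stack_sort \<rho> = \<pi>'" for \<rho>
      proof -
        have "[\<rho>] \<in> f ` forests \<pi>"
          using single[OF ne(2)] that bij_betw_imp_surj_on[OF f] by simp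
        then obtain fs where fs: "fs \<in> forests \<pi>" "f fs = [\<rho>]"
          by auto
        then have "length fs = 1"
          using st by (auto simp: fstat_def)
        then obtain \<sigma> where "fs = [\<sigma>]"
          by (auto simp: length_Suc_conv)
        with fs single[OF ne(1)] g(1) show ?thesis
          by (intro image_eqI[of _ _ \<sigma>]) auto
      qed
      with g(2) show "g ` {\<sigma>. stack_sort \<sigma> = \<pi>} = {\<sigma>. stack_sort \<sigma> = \<pi>'}"
        by blast
    qed
    moreover have "des (g \<sigma>) = des \<sigma> \<and> peak (g \<sigma>) = peak \<sigma> \<and> zeil (g \<sigma>) = zeil \<sigma>"
      if "stack_sort \<sigma> = \<pi>" for \<sigma>
    proof -
      have "fstat [g \<sigma>] = fstat [\<sigma>] \<and> fzeil [g \<sigma>] = fzeil [\<sigma>]"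
        using st single[OF ne(1)] that g(1)[OF that] by metis
      then show ?thesis
        by (simp add: fstat_def fzeil_def)
    qed
    ultimately show ?thesis
      by blast
  qed
qed

section \<open>Pattern avoidance of swung words\<close>

text \<open>Lists the ways to cut an explicit list, one entry at a time; with
  \<open>subseq_append_iff\<close> it turns occurrences of short patterns in \<open>X @ Y\<close>
  into finite case distinctions.\<close>

lemma ex_append_eq_Cons:
  "(\<exists>u v. x # xs = u @ v \<and> P u \<and> Q v) \<longleftrightarrow>
     P [] \<and> Q (x # xs) \<or> (\<exists>u v. xs = u @ v \<and> P (x # u) \<and> Q v)"
  by (auto simp: Cons_eq_append_conv)

lemma subseq_pair_append:
  "subseq [a, b] (X @ Y) \<longleftrightarrow> subseq [a, b] X \<or> (a \<in> set X \<and> b \<in> set Y) \<or> subseq [a, b] Y"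
  by (auto simp: subseq_append_iff ex_append_eq_Cons subseq_singleton_left)

lemma subseq_triple_append:
  "subseq [a, b, c] (X @ Y) \<longleftrightarrow> subseq [a, b, c] X \<or> (subseq [a, b] X \<and> c \<in> set Y) \<or>
     (a \<in> set X \<and> subseq [b, c] Y) \<or> subseq [a, b, c] Y"
  by (auto simp: subseq_append_iff ex_append_eq_Cons subseq_singleton_left)

lemma subseq_quadruple_append:
  "subseq [a, b, c, d] (X @ Y) \<longleftrightarrow> subseq [a, b, c, d] X \<or> (subseq [a, b, c] X \<and> d \<in> set Y) \<or>
     (subseq [a, b] X \<and> subseq [c, d] Y) \<or> (a \<in> set X \<and> subseq [b, c, d] Y) \<or> subseq [a, b, c, d] Y"
  by (auto simp: subseq_append_iff ex_append_eq_Cons subseq_singleton_left)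

lemmas subseq_short_append = subseq_pair_append subseq_triple_append subseq_quadruple_append

lemma subseq_set_subset: "subseq xs ys \<Longrightarrow> set xs \<subseteq> set ys"
  by (blast elim: list_emb_set)

lemma order_isomorphic_Nil [simp]: "order_isomorphic [] []"
  by (simp add: order_isomorphic_def)

lemma order_isomorphic_Cons:
  "order_isomorphic (x # xs) (y # ys) \<longleftrightarrow> order_isomorphic xs ys \<and>
     list_all2 (\<lambda>a b. (x < a \<longleftrightarrow> y < b) \<and> (a < x \<longleftrightarrow> b < y)) xs ys"
  by (auto simp: order_isomorphic_def All_less_Suc2 list_all2_conv_all_nth)

lemma avoids_312_iff:
  "avoids w [3, 1, 2] \<longleftrightarrow> (\<forall>a b c. subseq [a, b, c] w \<longrightarrow> \<not> (b < c \<and> c < a))"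
proof -
  have "order_isomorphic [a, b, c] [3, 1, 2] \<longleftrightarrow> b < c \<and> c < a" for a b c
    by (auto simp: order_isomorphic_Cons)
  moreover have "\<exists>a b c. xs = [a, b, c]" if "order_isomorphic xs [3, 1, 2]" for xs
    using that by (auto simp: order_isomorphic_def length_Suc_conv)
  ultimately show ?thesis
    unfolding avoids_def by metis
qed

lemma avoids_132_iff:
  "avoids w [1, 3, 2] \<longleftrightarrow> (\<forall>a b c. subseq [a, b, c] w \<longrightarrow> \<not> (a < c \<and> c < b))"
proof -
  have "order_isomorphic [a, b, c] [1, 3, 2] \<longleftrightarrow> a < c \<and> c < b" for a b c
    by (auto simp: order_isomorphic_Cons)
  moreover have "\<exists>a b c. xs = [a, b, c]" if "order_isomorphic xs [1, 3, 2]" for xs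
    using that by (auto simp: order_isomorphic_def length_Suc_conv)
  ultimately show ?thesis
    unfolding avoids_def by metis
qed

lemma avoids_3412_iff:
  "avoids w [3, 4, 1, 2] \<longleftrightarrow> (\<forall>a b c d. subseq [a, b, c, d] w \<longrightarrow> \<not> (c < d \<and> d < a \<and> a < b))"
proof -
  have "order_isomorphic [a, b, c, d] [3, 4, 1, 2] \<longleftrightarrow> c < d \<and> d < a \<and> a < b" for a b c d
    by (auto simp: order_isomorphic_Cons)
  moreover have "\<exists>a b c d. xs = [a, b, c, d]" if "order_isomorphic xs [3, 4, 1, 2]" for xs
    using that by (auto simp: order_isomorphic_def length_Suc_conv)
  ultimately show ?thesis
    unfolding avoids_def by metis
qed

lemma avoids_1342_iff:
  "avoids w [1, 3, 4, 2] \<longleftrightarrow> (\<forall>a b c d. subseq [a, b, c, d] w \<longrightarrow> \<not> (a < d \<and> d < b \<and> b < c))"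
proof -
  have "order_isomorphic [a, b, c, d] [1, 3, 4, 2] \<longleftrightarrow> a < d \<and> d < b \<and> b < c" for a b c d
    by (auto simp: order_isomorphic_Cons)
  moreover have "\<exists>a b c d. xs = [a, b, c, d]" if "order_isomorphic xs [1, 3, 4, 2]" for xs
    using that by (auto simp: order_isomorphic_def length_Suc_conv)
  ultimately show ?thesis
    unfolding avoids_def by metis
qed

lemma sorted_wrt_iff_subseq: "sorted_wrt P w \<longleftrightarrow> (\<forall>a b. subseq [a, b] w \<longrightarrow> P a b)"
proof (induction w)
  case (Cons x w)
  have "subseq [a, b] (x # w) \<longleftrightarrow> a = x \<and> b \<in> set w \<or> subseq [a, b] w" for a b
    using subseq_pair_append[of a b "[x]" w] by simp
  with Cons.IH show ?case
    by auto
qed simp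

text \<open>Yields the blocks of a word to be swung: avoidance rules out pairs in the wrong order,
  and then the two filters are consecutive blocks.\<close>

lemma filter_append_filter:
  assumes "\<And>a b. subseq [a, b] w \<Longrightarrow> P b \<Longrightarrow> P a"
  shows "w = filter P w @ filter (\<lambda>x. \<not> P x) w"
  using assms
proof (induction w)
  case (Cons x w)
  have IH: "w = filter P w @ filter (\<lambda>x. \<not> P x) w"
    using Cons.prems by (intro Cons.IH) (meson list_emb_Cons)
  show ?case
  proof (cases "P x")
    case False
    then have "filter P w = []"
      using Cons.prems[of x] by (auto simp: filter_empty_conv subseq_singleton_left)
    with IH False show ?thesis
      by simp
  qed (use IH in simp)
qed simp

text \<open>Occurrences within one block are excluded by induction, and most of those across blocks
  contradict the separation of values. What is left needs an ascent in \<open>A\<close> or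
  \<open>A'\<close> while \<open>B\<close> is nonempty, but then that block is decreasing.\<close>

lemma swing_avoids:
  assumes "swing w w'"
  shows "avoids w [1, 3, 2]" "avoids w [3, 4, 1, 2]" "avoids w' [3, 1, 2]" "avoids w' [1, 3, 4, 2]"
proof -
  from assms have "avoids w [1, 3, 2] \<and> avoids w [3, 4, 1, 2] \<and> avoids w' [3, 1, 2] \<and> avoids w' [1, 3, 4, 2]"
  proof (induction rule: swing.induct)
    case Nil
    show ?case
      unfolding avoids_132_iff avoids_312_iff avoids_1342_iff avoids_3412_iff by simp
  next
    case (snoc A A' B B' p)
    note [simp] = set_swing[OF snoc.hyps(1)] set_swing[OF snoc.hyps(2)]
    note ps = \<open>\<forall>a\<in>set A. p < a\<close> \<open>\<forall>b\<in>set B. b < p\<close>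
    have p: "p < a" if "a \<in> set A" for a
      using ps that by blast
    have q: "b < p" if "b \<in> set B" for b
      using ps that by blast
    have mem: "subseq [a, b] X \<Longrightarrow> a \<in> set X \<and> b \<in> set X"
      "subseq [a, b, c] X \<Longrightarrow> subseq [a, b] X \<and> a \<in> set X \<and> b \<in> set X \<and> c \<in> set X" for a b c X
      using subseq_set_subset[of "[a, b]" X] subseq_set_subset[of "[a, b, c]" X]
        subseq_order.trans[of "[a, b]" "[a, b, c]" X] by auto
    \<comment> \<open>The entry \<open>c\<close> only witnesses that \<open>B\<close> is nonempty,
      so that \<open>A\<close> is decreasing and \<open>A' = A\<close>.\<close>
    have srt: "subseq [a, b] A \<Longrightarrow> c \<in> set B \<Longrightarrow> b < a"
      "subseq [a, b] A' \<Longrightarrow> c \<in> set B \<Longrightarrow> b < a" for a b c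
      using snoc.hyps(5) swing_sorted[OF snoc.hyps(1)] by (auto simp: sorted_wrt_iff_subseq)
    note IH132 = snoc.IH[THEN conjunct1, unfolded avoids_132_iff]
    note IH3412 = snoc.IH[THEN conjunct2, THEN conjunct1, unfolded avoids_3412_iff]
    note IH312 = snoc.IH[THEN conjunct2, THEN conjunct2, THEN conjunct1, unfolded avoids_312_iff]
    note IH1342 = snoc.IH[THEN conjunct2, THEN conjunct2, THEN conjunct2, unfolded avoids_1342_iff]
    have "avoids (A @ B @ [p]) [1, 3, 2]"
      unfolding avoids_132_iff
    proof (intro allI impI notI, elim conjE)
      fix a b c assume s: "subseq [a, b, c] (A @ B @ [p])"
        and *: "a < c" "c < b"
      from s consider "subseq [a, b, c] A" | "subseq [a, b, c] B" | "a \<in> set A \<and> (c \<in> set B \<or> c = p)" | "b \<in> set B \<and> c = p"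
        by (auto simp: subseq_short_append dest: mem split: if_splits)
      then show False
      proof cases
        case 1
        with * IH132(1) show ?thesis by blast
      next
        case 2
        with * IH132(2) show ?thesis by blast
      qed (use * in \<open>auto dest!: p q\<close>)
    qed
    moreover have "avoids (A @ B @ [p]) [3, 4, 1, 2]"
      unfolding avoids_3412_iff
    proof (intro allI impI notI, elim conjE)
      fix a b c d assume s: "subseq [a, b, c, d] (A @ B @ [p])"
        and *: "c < d" "d < a" "a < b"
      from s consider "subseq [a, b, c, d] A" | "subseq [a, b, c, d] B" | "c \<in> set A \<and> (d \<in> set B \<or> d = p)" | "subseq [a, b] A \<and> c \<in> set B" | "a \<in> set A \<and> (b \<in> set B \<or> b = p)" | "a \<in> set B \<and> d = p"
        by (auto simp: subseq_short_append dest: mem split: if_splits)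
      then show False
      proof cases
        case 1
        with * IH3412(1) show ?thesis by blast
      next
        case 2
        with * IH3412(2) show ?thesis by blast
      next
        case 4
        with * srt show ?thesis by (meson less_asym)
      qed (use * in \<open>auto dest!: p q\<close>)
    qed
    moreover have "avoids (B' @ A' @ [p]) [3, 1, 2]"
      unfolding avoids_312_iff
    proof (intro allI impI notI, elim conjE)
      fix a b c assume s: "subseq [a, b, c] (B' @ A' @ [p])"
        and *: "b < c" "c < a"
      from s consider "subseq [a, b, c] A'" | "subseq [a, b, c] B'" | "a \<in> set B \<and> (c \<in> set A \<or> c = p)" | "b \<in> set A \<and> c = p"
        by (auto simp: subseq_short_append dest: mem split: if_splits)
      then show False
      proof cases
        case 1
        with * IH312(1) show ?thesis by blast
      next
        case 2
        with * IH312(2) show ?thesis by blast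
      qed (use * in \<open>auto dest!: p q\<close>)
    qed
    moreover have "avoids (B' @ A' @ [p]) [1, 3, 4, 2]"
      unfolding avoids_1342_iff
    proof (intro allI impI notI, elim conjE)
      fix a b c d assume s: "subseq [a, b, c, d] (B' @ A' @ [p])"
        and *: "a < d" "d < b" "b < c"
      from s consider "subseq [a, b, c, d] A'" | "subseq [a, b, c, d] B'" | "b \<in> set B \<and> (d \<in> set A \<or> d = p)" | "a \<in> set B \<and> subseq [b, c] A'" | "a \<in> set A \<and> d = p"
        using mem(1)[of c d A'] mem(2)[of b c d A'] mem(1)[of a b B'] mem(2)[of a b c B'] mem(2)[of a b c A']
        by (auto simp: subseq_short_append split: if_splits)
      then show False
      proof cases
        case 1
        with * IH1342(1) show ?thesis by blast
      next
        case 2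
        with * IH1342(2) show ?thesis by blast
      next
        case 4
        with * srt show ?thesis by (meson less_asym)
      qed (use * in \<open>auto dest!: p q\<close>)
    qed
    ultimately show ?case
      by blast
  qed
  then show "avoids w [1, 3, 2]" "avoids w [3, 4, 1, 2]" "avoids w' [3, 1, 2]" "avoids w' [1, 3, 4, 2]"
    by blast+
qed

lemma distinct_subseq: "subseq xs ys \<Longrightarrow> distinct ys \<Longrightarrow> distinct xs"
  by (auto simp: subseq_conv_nths distinct_nthsI)

lemma avoids_subseq: "avoids w \<tau> \<Longrightarrow> subseq v w \<Longrightarrow> avoids v \<tau>"
  unfolding avoids_def using subseq_order.trans by blast

text \<open>The last entry \<open>p\<close> plays the role of 2. A smaller entry before a larger one
  would give 132, so the larger ones come first; an ascent among them followed by an entry of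
  \<open>B\<close> and \<open>p\<close> would give 3412.\<close>

lemma swing_exists:
  assumes "distinct w" "avoids w [1, 3, 2]" "avoids w [3, 4, 1, 2]"
  shows "\<exists>w'. swing w w'"
  using assms
proof (induction w rule: length_induct)
  case (1 w)
  show ?case
  proof (cases w rule: rev_cases)
    case Nil
    then show ?thesis
      using swing.Nil by blast
  next
    case (snoc v p)
    define A where "A = filter (\<lambda>x. p < x) v"
    define B where "B = filter (\<lambda>x. \<not> p < x) v"
    have v: "v = A @ B"
      unfolding A_def B_def
    proof (rule filter_append_filter)
      fix a b assume ab: "subseq [a, b] v" "p < b"
      then have "subseq [a, b, p] w" "a \<in> set v"
        using subseq_set_subset[OF ab(1)] by (auto simp: snoc subseq_short_append)
      with 1(3) ab(2) 1(2) snoc show "p < a"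
        unfolding avoids_132_iff by (metis distinct_append distinct_length_2_or_more
            in_set_conv_decomp_first linorder_neqE_nat not_distinct_conv_prefix)
    qed
    have A: "\<forall>a \<in> set A. p < a"
      by (simp add: A_def)
    have B: "\<forall>b \<in> set B. b < p"
      using 1(2) snoc by (auto simp: B_def order_le_less not_less)
    have w: "w = A @ B @ [p]"
      using v snoc by simp
    have sub: "subseq A w" "subseq B w"
      unfolding w by (auto intro: subseq_drop_many subseq_rev_drop_many)
    have len: "length A < length w" "length B < length w"
      unfolding w by auto
    obtain A' B' where AB': "swing A A'" "swing B B'"
      using 1(1) len 1(2) avoids_subseq[OF 1(3)] avoids_subseq[OF 1(4)] sub unfolding w
      by (metis distinct_append)
    have "sorted_wrt (>) A" if "B \<noteq> []"
    proof -
      from that obtain b where b: "b \<in> set B" by (cases B) auto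
      have "b' < a" if ab: "subseq [a, b'] A" for a b'
      proof -
        have "subseq [a, b', b, p] w"
          unfolding w using ab b by (auto simp: subseq_short_append)
        moreover have "a \<noteq> b'"
        proof -
          have "distinct [a, b']"
            using ab 1(2) w by (metis distinct_append distinct_subseq)
          then show ?thesis by simp
        qed
        moreover have "b < p" "p < a"
          using B A b subseq_set_subset[OF ab] by auto
        ultimately show ?thesis
          using 1(4) unfolding avoids_3412_iff by (metis linorder_neqE_nat)
      qed
      then show ?thesis
        by (simp add: sorted_wrt_iff_subseq)
    qed
    then have "swing (A @ B @ [p]) (B' @ A' @ [p])"
      using AB' A B by (intro swing.snoc) auto
    then show ?thesis
      unfolding w by blast
  qed
qed

text \<open>Again \<open>p\<close> plays the role of 2. A larger entry before a smaller one would
  give 312, and an entry of \<open>B\<close> followed by an ascent in \<open>A\<close> and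
  \<open>p\<close> would give 1342.\<close>

lemma swing_exists_left:
  assumes "distinct w" "avoids w [3, 1, 2]" "avoids w [1, 3, 4, 2]"
  shows "\<exists>w'. swing w' w"
  using assms
proof (induction w rule: length_induct)
  case (1 w)
  show ?case
  proof (cases w rule: rev_cases)
    case Nil
    then show ?thesis
      using swing.Nil by blast
  next
    case (snoc v p)
    define B where "B = filter (\<lambda>x. x < p) v"
    define A where "A = filter (\<lambda>x. \<not> x < p) v"
    have v: "v = B @ A"
      unfolding A_def B_def
    proof (rule filter_append_filter)
      fix a b assume ab: "subseq [a, b] v" "b < p"
      then have "subseq [a, b, p] w" "a \<in> set v"
        using subseq_set_subset[OF ab(1)] by (auto simp: snoc subseq_short_append)
      moreover have "a \<noteq> p"
        using \<open>a \<in> set v\<close> 1(2) snoc by auto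
      ultimately show "a < p"
        using 1(3) ab(2) unfolding avoids_312_iff by (metis linorder_neqE_nat)
    qed
    have B: "\<forall>b \<in> set B. b < p"
      by (simp add: B_def)
    have A: "\<forall>a \<in> set A. p < a"
      using 1(2) snoc by (auto simp: A_def order_le_less not_less)
    have w: "w = B @ A @ [p]"
      using v snoc by simp
    have sub: "subseq A w" "subseq B w"
      unfolding w by (auto intro: subseq_drop_many subseq_rev_drop_many)
    have len: "length A < length w" "length B < length w"
      unfolding w by auto
    obtain A' B' where AB': "swing A' A" "swing B' B"
      using 1(1) len 1(2) avoids_subseq[OF 1(3)] avoids_subseq[OF 1(4)] sub unfolding w
      by (metis distinct_append)
    have "sorted_wrt (>) A" if "B \<noteq> []"
    proof -
      from that obtain b where b: "b \<in> set B" by (cases B) auto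
      have "b' < a" if ab: "subseq [a, b'] A" for a b'
      proof -
        have "subseq [b, a, b', p] w"
          unfolding w using ab b by (auto simp: subseq_short_append)
        moreover have "a \<noteq> b'"
        proof -
          have "distinct [a, b']"
            using ab 1(2) w by (metis distinct_append distinct_subseq)
          then show ?thesis by simp
        qed
        moreover have "b < p" "p < a"
          using B A b subseq_set_subset[OF ab] by auto
        ultimately show ?thesis
          using 1(4) unfolding avoids_1342_iff by (metis linorder_neqE_nat)
      qed
      then show ?thesis
        by (simp add: sorted_wrt_iff_subseq)
    qed
    \<comment> \<open>The rule \<open>snoc\<close> asks for the block before swinging, here
      \<open>A'\<close>, to be decreasing; \<open>swing_sorted\<close> identifies it with
      \<open>A\<close>.\<close>
    then have "B' = [] \<or> sorted_wrt (>) A'"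
      using swing_sorted[OF AB'(1)] swing_Nil_iff[OF AB'(2)] by blast
    then have "swing (A' @ B' @ [p]) (B @ A @ [p])"
      using AB' A B set_swing[OF AB'(1)] set_swing[OF AB'(2)] by (intro swing.snoc) auto
    then show ?thesis
      unfolding w by blast
  qed
qed

section \<open>Alternating patterns\<close>

text \<open>A code lists the appended extremal entries, the last one first, with \<open>True\<close>
  for a maximum and \<open>False\<close> for a minimum. An occurrence is found by picking
  \<open>x\<close> for the last entry and searching the rest before \<open>x\<close> on the proper
  side; \<open>contains_code_iff\<close> links this to \<open>code_perm\<close>.\<close>

fun contains_code :: "bool list \<Rightarrow> nat list \<Rightarrow> bool" where
  "contains_code [] w \<longleftrightarrow> w \<noteq> []"
| "contains_code (b # bs) w \<longleftrightarrow>
     (\<exists>u x v. w = u @ x # v \<and> contains_code bs (filter (\<lambda>y. if b then y < x else x < y) u))"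

fun code_perm :: "bool list \<Rightarrow> nat list" where
  "code_perm [] = [1]"
| "code_perm (b # bs) = (if b then code_perm bs \<oplus> [1] else code_perm bs \<ominus> [1])"

lemma contains_code_ConsI:
  "contains_code bs (filter (\<lambda>y. if b then y < x else x < y) u) \<Longrightarrow> contains_code (b # bs) (u @ x # v)"
  by (auto simp only: contains_code.simps)

lemma contains_code_mono: "contains_code bs u \<Longrightarrow> subseq u w \<Longrightarrow> contains_code bs w"
proof (induction bs arbitrary: u w)
  case Nil
  then show ?case by auto
next
  case (Cons b bs)
  then obtain u1 x v where u: "u = u1 @ x # v"
    "contains_code bs (filter (\<lambda>y. if b then y < x else x < y) u1)"
    by auto
  from Cons.prems(2)[unfolded u(1)] obtain w1 w2 where w: "w = w1 @ w2" "subseq u1 w1" "subseq (x # v) w2"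
    by (auto dest: list_emb_appendD)
  from w(3) obtain w3 w4 where w2: "w2 = w3 @ x # w4"
    by (auto dest: list_emb_ConsD)
  have "subseq u1 (w1 @ w3)"
    using w(2) by (rule subseq_rev_drop_many)
  then have "contains_code bs (filter (\<lambda>y. if b then y < x else x < y) (w1 @ w3))"
    using Cons.IH[OF u(2)] subseq_filter by blast
  then show ?case
    using contains_code_ConsI[of bs b x "w1 @ w3" w4] w(1) w2 by simp
qed

text \<open>A pattern whose last entry is extremal on the side away from a block decomposition cannot be split
  between the two blocks.\<close>

lemma contains_code_append_far:
  assumes "\<forall>x \<in> set U. \<forall>y \<in> set V. if b then y < x else x < y"
  shows "contains_code (b # bs) (U @ V) \<longleftrightarrow> contains_code (b # bs) U \<or> contains_code (b # bs) V"
proof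
  assume "contains_code (b # bs) (U @ V)"
  then obtain u x v where *: "U @ V = u @ x # v"
    "contains_code bs (filter (\<lambda>y. if b then y < x else x < y) u)"
    by auto
  from *(1) consider v' where "U = u @ x # v'" | u' where "u = U @ u'" "V = u' @ x # v"
    by (auto simp: append_eq_append_conv2 Cons_eq_append_conv append_eq_Cons_conv)
  then show "contains_code (b # bs) U \<or> contains_code (b # bs) V"
  proof cases
    case 1
    with contains_code_ConsI[OF *(2)] show ?thesis by blast
  next
    case 2
    \<comment> \<open>An \<open>x\<close> chosen in \<open>V\<close> has all of \<open>U\<close> on
      the wrong side, so the rest of the occurrence lies in \<open>V\<close> as well.\<close>
    then have "filter (\<lambda>y. if b then y < x else x < y) U = []"
      using assms by (auto simp: filter_empty_conv split: if_splits dest: less_asym)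
    with *(2) 2(1) have "contains_code bs (filter (\<lambda>y. if b then y < x else x < y) u')"
      by simp
    with contains_code_ConsI 2(2) show ?thesis by blast
  qed
next
  assume "contains_code (b # bs) U \<or> contains_code (b # bs) V"
  then show "contains_code (b # bs) (U @ V)"
    using contains_code_mono subseq_drop_many[of V V U] subseq_rev_drop_many[of U U V] by blast
qed

text \<open>Here the last entry may lie in \<open>V\<close> and the rest in \<open>U\<close>. The
  rest itself cannot be split: by alternation its last entry is extremal in the opposite direction,
  and for that direction \<open>contains_code_append_far\<close> applies.\<close>

lemma contains_code_append_near:
  assumes sep: "\<forall>x \<in> set U. \<forall>y \<in> set V. if b then x < y else y < x"
    and alt: "successively (\<noteq>) (b # bs)"
  shows "contains_code (b # bs) (U @ V) \<longleftrightarrow>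
    contains_code (b # bs) U \<or> contains_code (b # bs) V \<or> contains_code bs U \<and> V \<noteq> []"
proof
  assume "contains_code (b # bs) (U @ V)"
  then obtain u x v where *: "U @ V = u @ x # v"
    "contains_code bs (filter (\<lambda>y. if b then y < x else x < y) u)"
    by auto
  from *(1) consider v' where "U = u @ x # v'" | u' where "u = U @ u'" "V = u' @ x # v"
    by (auto simp: append_eq_append_conv2 Cons_eq_append_conv append_eq_Cons_conv)
  then show "contains_code (b # bs) U \<or> contains_code (b # bs) V \<or> contains_code bs U \<and> V \<noteq> []"
  proof cases
    case 1
    with contains_code_ConsI[OF *(2)] show ?thesis by blast
  next
    case 2
    let ?f = "filter (\<lambda>y. if b then y < x else x < y)"
    have "?f U = U"
      using sep 2 by (auto simp: filter_id_conv split: if_splits)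
    then have "contains_code bs (U @ ?f u')"
      using *(2) 2 by simp
    moreover have "\<forall>x \<in> set U. \<forall>y \<in> set (?f u'). if \<not> b then y < x else x < y"
      using sep 2 by auto
    ultimately have "contains_code bs U \<or> contains_code bs (?f u')"
    proof (cases bs)
      case (Cons c cs)
      with alt have "bs = (\<not> b) # cs" by auto
      with \<open>contains_code bs (U @ ?f u')\<close> show ?thesis
        using contains_code_append_far[of U "?f u'" "\<not> b" cs]
          \<open>\<forall>x \<in> set U. \<forall>y \<in> set (?f u'). if \<not> b then y < x else x < y\<close> by blast
    qed auto
    with contains_code_ConsI[of bs b x u' v] 2(2) show ?thesis by blast
  qed
next
  assume "contains_code (b # bs) U \<or> contains_code (b # bs) V \<or> contains_code bs U \<and> V \<noteq> []"
  then consider "contains_code (b # bs) U" | "contains_code (b # bs) V" | "contains_code bs U" "V \<noteq> []"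
    by blast
  then show "contains_code (b # bs) (U @ V)"
  proof cases
    case 1
    then show ?thesis
      using contains_code_mono subseq_rev_drop_many[of U U V] by blast
  next
    case 2
    then show ?thesis
      using contains_code_mono subseq_drop_many[of V V U] by blast
  next
    case 3
    \<comment> \<open>Every entry of \<open>V\<close> is on the proper side of all of
      \<open>U\<close>, so the first one can serve as the last entry of the pattern.\<close>
    then obtain y V' where V: "V = y # V'" by (cases V) auto
    then have "filter (\<lambda>z. if b then z < y else y < z) U = U"
      using sep by (auto simp: filter_id_conv split: if_splits)
    with 3(1) V show ?thesis
      using contains_code_ConsI[of bs b y U V'] by simp
  qed
qed

lemma contains_code_single: "\<not> contains_code (b # bs) [p]"
proof -
  have "\<not> contains_code bs []"
    by (cases bs) auto
  then show ?thesis
    by (auto simp: Cons_eq_append_conv)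
qed

declare contains_code.simps(2) [simp del]

text \<open>Up to the induction hypothesis, both words contain the pattern under the same condition.
  If its last entry is a maximum, either \<open>A\<close> or \<open>B\<close> contains it or
  \<open>B\<close> contains the rest, since \<open>p\<close> follows \<open>B\<close> from above in
  both words. If it is a minimum, the rest may instead lie in \<open>A\<close>, since
  \<open>p\<close> follows \<open>A\<close> from below.\<close>

lemma swing_contains_code:
  "swing w w' \<Longrightarrow> successively (\<noteq>) bs \<Longrightarrow> contains_code bs w \<longleftrightarrow> contains_code bs w'"
proof (induction arbitrary: bs rule: swing.induct)
  case (snoc A A' B B' p)
  note [simp] = set_swing[OF snoc.hyps(1)] set_swing[OF snoc.hyps(2)]
  note Nil_iff = swing_Nil_iff[OF snoc.hyps(1)] swing_Nil_iff[OF snoc.hyps(2)]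
  have p: "p < a" if "a \<in> set A" for a
    using snoc.hyps(3) that by blast
  have q: "b < p" if "b \<in> set B" for b
    using snoc.hyps(4) that by blast
  have AB: "b < a" if "a \<in> set A" "b \<in> set B" for a b
    using p[OF that(1)] q[OF that(2)] by simp
  show ?case
  proof (cases bs)
    case (Cons c cs)
    have alt: "successively (\<noteq>) (c # cs)" "successively (\<noteq>) cs"
      using snoc.prems Cons by (auto simp: successively_Cons)
    note IH = snoc.IH(1)[OF alt(1)] snoc.IH(1)[OF alt(2)] snoc.IH(2)[OF alt(1)] snoc.IH(2)[OF alt(2)]
    show ?thesis
    proof (cases c)
      case True
      have "contains_code bs (A @ B @ [p]) \<longleftrightarrow> contains_code bs A \<or> contains_code bs (B @ [p])"
        unfolding Cons using True AB p by (intro contains_code_append_far) auto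
      moreover have "contains_code bs (B @ [p]) \<longleftrightarrow> contains_code bs B \<or> contains_code cs B"
        unfolding Cons using True q alt contains_code_single
        by (subst contains_code_append_near) auto
      moreover have "contains_code bs (B' @ A' @ [p]) \<longleftrightarrow>
          contains_code bs B' \<or> contains_code bs (A' @ [p]) \<or> contains_code cs B'"
        unfolding Cons using True q AB alt by (subst contains_code_append_near) auto
      moreover have "contains_code bs (A' @ [p]) \<longleftrightarrow> contains_code bs A'"
        unfolding Cons using True p contains_code_single by (subst contains_code_append_far) auto
      ultimately show ?thesis
        using IH Cons by metis
    next
      case False
      have "contains_code bs (A @ B @ [p]) \<longleftrightarrow>
          contains_code bs A \<or> contains_code bs (B @ [p]) \<or> contains_code cs A"
        unfolding Cons using False AB p alt by (subst contains_code_append_near) auto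
      moreover have "contains_code bs (B @ [p]) \<longleftrightarrow> contains_code bs B"
        unfolding Cons using False q contains_code_single by (subst contains_code_append_far) auto
      moreover have "contains_code bs (B' @ A' @ [p]) \<longleftrightarrow> contains_code bs B' \<or> contains_code bs (A' @ [p])"
        unfolding Cons using False AB q by (intro contains_code_append_far) auto
      moreover have "contains_code bs (A' @ [p]) \<longleftrightarrow> contains_code bs A' \<or> contains_code cs A'"
        unfolding Cons using False p alt contains_code_single
        by (subst contains_code_append_near) auto
      ultimately show ?thesis
        using IH Cons by metis
    qed
  qed simp
qed simp

section \<open>Codes as permutations\<close>

lemma code_perm_perms: "code_perm bs \<in> perms (Suc (length bs))"
proof (induction bs)
  case (Cons b bs)
  note p = permsD[OF Cons.IH]
  have "set (code_perm (b # bs)) = {1..Suc (Suc (length bs))}"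
  proof -
    have "Suc ` {1..Suc (length bs)} = {2..Suc (Suc (length bs))}"
      using image_Suc_atLeastAtMost[of 1 "Suc (length bs)"] by (simp add: numeral_2_eq_2)
    then show ?thesis
      using p(1,3) by (auto simp: oplus_def ominus_def)
  qed
  moreover have "distinct (code_perm (b # bs))"
    using p by (auto simp: oplus_def ominus_def distinct_map)
  ultimately show ?case
    by (simp add: permutations_of_set_def)
qed (simp add: permutations_of_set_def)

lemma order_isomorphic_snoc:
  "order_isomorphic (xs @ [x]) (ys @ [y]) \<longleftrightarrow> order_isomorphic xs ys \<and>
     list_all2 (\<lambda>a b. (x < a \<longleftrightarrow> y < b) \<and> (a < x \<longleftrightarrow> b < y)) xs ys"
proof (cases "length xs = length ys")
  case True
  then show ?thesis
    by (auto simp: order_isomorphic_def All_less_Suc nth_append list_all2_conv_all_nth)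
qed (auto simp: order_isomorphic_def list_all2_conv_all_nth)

lemma order_isomorphic_map_Suc: "order_isomorphic xs (map Suc ys) \<longleftrightarrow> order_isomorphic xs ys"
  by (auto simp: order_isomorphic_def)

lemma subseq_snocE:
  assumes "subseq (ys @ [x]) w"
  obtains u v where "w = u @ x # v" "subseq ys u"
proof -
  from assms obtain w1 w2 where w: "w = w1 @ w2" "subseq ys w1" "subseq [x] w2"
    by (auto dest: list_emb_appendD)
  then obtain w3 w4 where "w2 = w3 @ x # w4"
    by (auto simp: subseq_singleton_left dest: split_list)
  with w show thesis
    by (intro that[of "w1 @ w3" w4]) (auto intro: subseq_rev_drop_many)
qed

text \<open>Since \<open>y\<close> compares in the same way with all of \<open>\<tau>\<close>, the
  entry \<open>x\<close> playing its role only has to lie on one side of the occurrence of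
  \<open>\<tau>\<close>. Leaving \<open>y\<close> arbitrary covers appended maxima and minima
  alike.\<close>

lemma contains_snoc_extremal:
  assumes \<tau>: "\<forall>t \<in> set \<tau>. if b then t < y else y < t"
  shows "\<not> avoids w (\<tau> @ [y]) \<longleftrightarrow>
    (\<exists>u x v. w = u @ x # v \<and> \<not> avoids (filter (\<lambda>z. if b then z < x else x < z) u) \<tau>)"
proof
  assume "\<not> avoids w (\<tau> @ [y])"
  then obtain xs where xs: "subseq xs w" "order_isomorphic xs (\<tau> @ [y])"
    by (auto simp: avoids_def)
  then obtain ys x where ys: "xs = ys @ [x]"
    by (cases xs rule: rev_cases) (auto simp: order_isomorphic_def)
  with xs(2) have iso: "order_isomorphic ys \<tau>"
    and l: "list_all2 (\<lambda>a b. (x < a \<longleftrightarrow> y < b) \<and> (a < x \<longleftrightarrow> b < y)) ys \<tau>"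
    by (auto simp: order_isomorphic_snoc)
  have "\<forall>z \<in> set ys. if b then z < x else x < z"
    using l \<tau> by (induction rule: list_all2_induct) (auto split: if_splits)
  then have "filter (\<lambda>z. if b then z < x else x < z) ys = ys"
    by (simp only: filter_id_conv)
  moreover obtain u v where w: "w = u @ x # v" "subseq ys u"
    using xs(1) unfolding ys by (rule subseq_snocE)
  ultimately have "subseq ys (filter (\<lambda>z. if b then z < x else x < z) u)"
    using subseq_filter by metis
  with iso w show "\<exists>u x v. w = u @ x # v \<and> \<not> avoids (filter (\<lambda>z. if b then z < x else x < z) u) \<tau>"
    unfolding avoids_def by blast
next
  assume "\<exists>u x v. w = u @ x # v \<and> \<not> avoids (filter (\<lambda>z. if b then z < x else x < z) u) \<tau>"
  then obtain u x v ys where *: "w = u @ x # v"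
    "subseq ys (filter (\<lambda>z. if b then z < x else x < z) u)" "order_isomorphic ys \<tau>"
    unfolding avoids_def by blast
  have "\<forall>z \<in> set ys. if b then z < x else x < z"
    using subseq_set_subset[OF *(2)] by auto
  moreover have "length ys = length \<tau>"
    using *(3) by (simp add: order_isomorphic_def)
  ultimately have "list_all2 (\<lambda>a c. (x < a \<longleftrightarrow> y < c) \<and> (a < x \<longleftrightarrow> c < y)) ys \<tau>"
    using \<tau> by (intro list_all2_all_nthI) (metis less_asym nth_mem)+
  with *(3) have "order_isomorphic (ys @ [x]) (\<tau> @ [y])"
    by (simp add: order_isomorphic_snoc)
  moreover have "subseq (ys @ [x]) w"
    unfolding *(1) using subseq_order.trans[OF *(2) subseq_filter_left]
    by (intro list_emb_append_mono) auto
  ultimately show "\<not> avoids w (\<tau> @ [y])"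
    unfolding avoids_def by blast
qed

lemma contains_oplus_one:
  assumes "\<tau> \<in> perms k"
  shows "\<not> avoids w (\<tau> \<oplus> [1]) \<longleftrightarrow> (\<exists>u x v. w = u @ x # v \<and> \<not> avoids (filter (\<lambda>z. z < x) u) \<tau>)"
  using contains_snoc_extremal[of \<tau> True "Suc k" w] permsD[OF assms] by (simp add: oplus_def)

lemma contains_ominus_one:
  assumes "\<tau> \<in> perms k"
  shows "\<not> avoids w (\<tau> \<ominus> [1]) \<longleftrightarrow> (\<exists>u x v. w = u @ x # v \<and> \<not> avoids (filter (\<lambda>z. x < z) u) \<tau>)"
proof -
  have "avoids u (map Suc \<tau>) \<longleftrightarrow> avoids u \<tau>" for u
    by (simp add: avoids_def order_isomorphic_map_Suc)
  then show ?thesis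
    using contains_snoc_extremal[of "map Suc \<tau>" False 1 w] permsD[OF assms] by (simp add: ominus_def)
qed

lemma contains_code_iff: "contains_code bs w \<longleftrightarrow> \<not> avoids w (code_perm bs)"
proof (induction bs arbitrary: w)
  case Nil
  have iso: "order_isomorphic xs [1] \<longleftrightarrow> (\<exists>x. xs = [x])" for xs
    by (auto simp: order_isomorphic_def length_Suc_conv)
  have "avoids w [1] \<longleftrightarrow> (\<forall>x. \<not> subseq [x] w)"
    unfolding avoids_def iso by blast
  moreover have "(\<forall>x. \<not> subseq [x] w) \<longleftrightarrow> w = []"
    by (cases w) (auto simp: subseq_singleton_left)
  ultimately show ?case
    unfolding contains_code.simps code_perm.simps by blast
next
  case (Cons b bs)
  then show ?case
    using contains_oplus_one[OF code_perm_perms, of w bs] contains_ominus_one[OF code_perm_perms, of w bs]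
    by (simp add: contains_code.simps(2))
qed

text \<open>In 132 the last entry lies strictly between two others, so an appended extremal entry
  cannot take part. Hence coded patterns lie in the domain of \<open>swl\<close>.\<close>

lemma code_perm_avoids_132: "avoids (code_perm bs) [1, 3, 2]"
proof (induction bs)
  case Nil
  show ?case
    unfolding avoids_132_iff by auto
next
  case (Cons b bs)
  note p = permsD[OF code_perm_perms[of bs]]
  show ?case
    unfolding avoids_132_iff
  proof (intro allI impI notI, elim conjE)
    fix x y z assume s: "subseq [x, y, z] (code_perm (b # bs))" and *: "x < z" "z < y"
    have mem: "x \<in> set w \<and> y \<in> set w" if "subseq [x, y] w" for w
      using subseq_set_subset[OF that] by auto
    show False
    proof (cases b)
      case True
      then have "subseq [x, y, z] (code_perm bs) \<or> y \<in> set (code_perm bs) \<and> z = Suc (Suc (length bs))"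
        using s p(3) mem by (auto simp: oplus_def subseq_short_append split: if_splits)
      with Cons.IH * p(1) show False
        unfolding avoids_132_iff by auto
    next
      case False
      then have "subseq [x, y, z] (map Suc (code_perm bs)) \<or> x \<in> Suc ` set (code_perm bs) \<and> z = 1"
        using s mem[of "map Suc (code_perm bs)"] by (auto simp: ominus_def subseq_short_append split: if_splits)
      then show False
      proof
        assume "subseq [x, y, z] (map Suc (code_perm bs))"
        then have "\<not> avoids (map Suc (code_perm bs)) [1, 3, 2]"
          using * unfolding avoids_132_iff by blast
        then obtain xs where xs: "subseq xs (map Suc (code_perm bs))" "order_isomorphic xs [1, 3, 2]"
          by (auto simp: avoids_def)
        then obtain N where "xs = map Suc (nths (code_perm bs) N)"
          by (auto simp: subseq_conv_nths nths_map)
        with xs(2) have "order_isomorphic (nths (code_perm bs) N) [1, 3, 2]"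
          by (auto simp: order_isomorphic_def)
        with Cons.IH show False
          unfolding avoids_def subseq_conv_nths by blast
      qed (use *(1) in auto)
    qed
  qed
qed

section \<open>The maps \<open>rot\<close>, \<open>chi\<close> and \<open>swu\<close>, and the
  patterns in \<B>\<close>

lemma inv_perm_eqI:
  assumes "\<pi> \<in> perms n" "length \<sigma> = n" "\<And>i. i < n \<Longrightarrow> \<sigma> ! (\<pi> ! i - 1) = Suc i"
  shows "inv_perm \<pi> = \<sigma>"
proof (rule nth_equalityI)
  fix j assume "j < length (inv_perm \<pi>)"
  then have j: "j < n" using permsD(3)[OF assms(1)] by simp
  then have "Suc j \<in> set \<pi>" using permsD(1)[OF assms(1)] by simp
  then obtain i where "i < n" "\<pi> ! i = Suc j"
    using permsD(3)[OF assms(1)] by (auto simp: in_set_conv_nth)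
  with inv_perm_nth[OF assms(1), of i] assms(3)[of i] show "inv_perm \<pi> ! j = \<sigma> ! j"
    by simp
qed (use assms(2) permsD(3)[OF assms(1)] in simp)

lemma perms_snoc_max: "\<pi> \<in> perms n \<Longrightarrow> \<pi> @ [Suc n] \<in> perms (Suc n)"
  by (auto simp: permutations_of_set_def)

lemma perms_Cons_max: "\<pi> \<in> perms n \<Longrightarrow> Suc n # \<pi> \<in> perms (Suc n)"
  by (auto simp: permutations_of_set_def)

lemma perms_nth:
  assumes "\<pi> \<in> perms n" "i < n"
  shows "1 \<le> \<pi> ! i \<and> \<pi> ! i \<le> n"
  using permsD[OF assms(1)] nth_mem[of i \<pi>] assms(2) by auto

lemma perms_rev: "\<pi> \<in> perms n \<Longrightarrow> rev \<pi> \<in> perms n"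
  by (simp add: permutations_of_set_def)

lemma rot_inv_perms: "\<pi> \<in> perms n \<Longrightarrow> rot_inv \<pi> \<in> perms n"
  unfolding rot_inv_def by (intro inv_perm_in_perms perms_rev)

lemma rot_perms: "\<pi> \<in> perms n \<Longrightarrow> rot \<pi> \<in> perms n"
  unfolding rot_def by (intro inv_perm_in_perms perms_rev)

text \<open>Reversal moves \<open>Suc n\<close> to the last position, where it is a fixed point, and
  inversion keeps it there.\<close>

lemma rot_inv_Cons_max:
  assumes "\<pi> \<in> perms n"
  shows "rot_inv (Suc n # \<pi>) = rot_inv \<pi> \<oplus> [1]"
proof -
  have r: "rev \<pi> \<in> perms n"
    by (rule perms_rev[OF assms])
  note len = permsD(3)[OF r]
  have "inv_perm (rev \<pi> @ [Suc n]) = inv_perm (rev \<pi>) @ [Suc n]"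
  proof (rule inv_perm_eqI[OF perms_snoc_max[OF r]])
    fix i assume "i < Suc n"
    then show "(inv_perm (rev \<pi>) @ [Suc n]) ! ((rev \<pi> @ [Suc n]) ! i - 1) = Suc i"
      using inv_perm_nth[OF r, of i] perms_nth[OF r, of i] len
      by (cases "i = n") (auto simp: nth_append)
  qed (use len in simp)
  then show ?thesis
    using len by (simp add: rot_inv_def oplus_def)
qed

text \<open>Reversal moves \<open>Suc n\<close> to the first position and shifts the other positions
  up; in the inverse the last entry is therefore 1 and the others grow by one.\<close>

lemma rot_inv_snoc_max:
  assumes "\<pi> \<in> perms n"
  shows "rot_inv (\<pi> @ [Suc n]) = rot_inv \<pi> \<ominus> [1]"
proof -
  have r: "rev \<pi> \<in> perms n"
    by (rule perms_rev[OF assms])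
  note len = permsD(3)[OF r]
  have "inv_perm (Suc n # rev \<pi>) = map Suc (inv_perm (rev \<pi>)) @ [1]"
  proof (rule inv_perm_eqI[OF perms_Cons_max[OF r]])
    fix i assume i: "i < Suc n"
    show "(map Suc (inv_perm (rev \<pi>)) @ [1]) ! ((Suc n # rev \<pi>) ! i - 1) = Suc i"
    proof (cases i)
      case (Suc j)
      then have "rev \<pi> ! j - 1 < n"
        using perms_nth[OF r, of j] i by auto
      with Suc i inv_perm_nth[OF r, of j] len show ?thesis
        by (simp add: nth_append)
    qed (use len in \<open>simp add: nth_append\<close>)
  qed (use len in simp)
  then show ?thesis
    by (simp add: rot_inv_def ominus_def)
qed

lemma chi_0: "chi 0 \<pi> = \<pi>"
  by (simp add: chi_def)

lemma chi_Suc: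
  "chi (Suc m) \<pi> = (if even m then Suc (length \<pi> + m) # chi m \<pi> else chi m \<pi> @ [Suc (length \<pi> + m)])"
  by (simp add: chi_def)

lemma chi_perms: "\<pi> \<in> perms n \<Longrightarrow> chi m \<pi> \<in> perms (n + m)"
proof (induction m)
  case (Suc m)
  then show ?case
    using perms_Cons_max[OF Suc.IH] perms_snoc_max[OF Suc.IH] permsD(3)[OF Suc.prems]
    by (simp add: chi_Suc)
qed (simp add: chi_0)

lemma chi_tilde_perms:
  assumes "\<pi> \<in> perms n"
  shows "chi_tilde m \<pi> \<in> perms (n + m)"
  unfolding chi_tilde_def by (intro rot_inv_perms chi_perms rot_perms assms)

lemma chi_tilde_0: "\<pi> \<in> perms n \<Longrightarrow> chi_tilde 0 \<pi> = \<pi>"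
  by (simp add: chi_tilde_def chi_0 rot_inv_rot)

lemma chi_tilde_Suc:
  assumes "\<pi> \<in> perms n"
  shows "chi_tilde (Suc m) \<pi> = (if even m then chi_tilde m \<pi> \<oplus> [1] else chi_tilde m \<pi> \<ominus> [1])"
  using chi_perms[OF rot_perms[OF assms], of m] permsD(3)[OF rot_perms[OF assms]]
  by (simp add: chi_tilde_def chi_Suc rot_inv_Cons_max rot_inv_snoc_max)

lemma swu_Cons_max: "\<pi> \<in> perms n \<Longrightarrow> swu (Suc n # \<pi>) = [1] \<ominus> swu \<pi>"
  using swu_oplus[of "[]" 0 \<pi> n] permsD(3)[of \<pi> n]
  by (simp add: oplus_def ominus_def swu_Nil permutations_of_set_def)

lemma swu_snoc_max: "\<pi> \<in> perms n \<Longrightarrow> swu (\<pi> @ [Suc n]) = swu \<pi> \<oplus> [1]"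
  using swu_oplus[of \<pi> n "[]" 0] permsD(3)[of \<pi> n]
  by (simp add: oplus_def ominus_def swu_Nil permutations_of_set_def)

text \<open>\<open>swu\<close> passes through a new maximum at either end, so a word fixed by it
  stays fixed under every extension step.\<close>

lemma swu_chi:
  assumes "\<pi> \<in> perms n" "swu \<pi> = \<pi>"
  shows "swu (chi m \<pi>) = chi m \<pi>"
proof (induction m)
  case (Suc m)
  note c = chi_perms[OF assms(1), of m]
  show ?case
    using Suc swu_Cons_max[OF c] swu_snoc_max[OF c] permsD(3)[OF c] permsD(3)[OF assms(1)]
    by (simp add: chi_Suc oplus_def ominus_def)
qed (use assms in \<open>simp add: chi_0\<close>)

lemma swl_chi_tilde:
  assumes "\<pi> \<in> perms n" "swu (rot \<pi>) = rot \<pi>"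
  shows "swl (chi_tilde m \<pi>) = chi_tilde m \<pi>"
  using swu_chi[OF rot_perms[OF assms(1)] assms(2)] rot_rot_inv[OF chi_perms[OF rot_perms[OF assms(1)]]]
  by (simp add: swl_def chi_tilde_def)

text \<open>The flag \<open>even m\<close> is the one that the next extension step puts in front, so
  the invariant keeps the code alternating. For \<open>m = 0\<close> it is \<open>True\<close>,
  whence the assumption on \<open>True # bs\<close>.\<close>

lemma chi_tilde_code_perm:
  assumes "successively (\<noteq>) (True # bs)"
  shows "\<exists>cs. chi_tilde m (code_perm bs) = code_perm cs \<and> successively (\<noteq>) (even m # cs)"
proof (induction m)
  case 0
  show ?case
    using assms chi_tilde_0[OF code_perm_perms] by auto
next
  case (Suc m)
  then obtain cs where "chi_tilde m (code_perm bs) = code_perm cs" "successively (\<noteq>) (even m # cs)"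
    by blast
  then show ?case
    using chi_tilde_Suc[OF code_perm_perms, of m bs] by (intro exI[of _ "even m # cs"]) auto
qed

lemma rot_short: "rot [1] = [1]" "rot [2, 1] = [1, 2]"
proof -
  have "inv_perm [1] = [1]"
    by (rule inv_perm_eqI[of _ 1]) (auto simp: permutations_of_set_def)
  moreover have "inv_perm [2, 1] = [2, 1]"
    by (rule inv_perm_eqI[of _ 2]) (auto simp: permutations_of_set_def less_Suc_eq numeral_2_eq_2)
  ultimately show "rot [1] = [1]" "rot [2, 1] = [1, 2]"
    by (simp_all add: rot_def)
qed

lemma swu_short: "swu [1] = [1]" "swu [1, 2] = [1, 2]"
proof -
  show 1: "swu [1] = [1]"
    using swu_Cons_max[of "[]" 0] by (simp add: ominus_def swu_Nil permutations_of_set_def)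
  show "swu [1, 2] = [1, 2]"
    using swu_snoc_max[of "[1]" 1] 1 by (simp add: oplus_def permutations_of_set_def numeral_2_eq_2)
qed

text \<open>The entries 243 form a 132, and each extension step appends one entry, so an occurrence
  of the extended pattern contains one of the previous pattern.\<close>

lemma contains_chi_tilde_2431:
  "\<not> avoids w (chi_tilde m [2, 4, 3, 1]) \<Longrightarrow> \<not> avoids w [1, 3, 2]"
proof (induction m arbitrary: w)
  case 0
  have perm: "[2, 4, 3, 1] \<in> perms 4"
    by (auto simp: permutations_of_set_def)
  from 0 obtain xs where xs: "subseq xs w" "order_isomorphic xs [2, 4, 3, 1]"
    unfolding chi_tilde_0[OF perm] avoids_def by blast
  then obtain a b c d where abcd: "xs = [a, b, c, d]"
    by (auto simp: order_isomorphic_def length_Suc_conv)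
  have "order_isomorphic [a, b, c] [1, 3, 2]"
    using xs(2) by (auto simp: abcd order_isomorphic_Cons)
  moreover have "subseq [a, b, c] w"
    using xs(1) unfolding abcd by (rule subseq_order.trans[rotated]) simp
  ultimately show ?case
    unfolding avoids_def by blast
next
  case (Suc m)
  have perm: "[2, 4, 3, 1] \<in> perms 4"
    by (auto simp: permutations_of_set_def)
  obtain u x v P where w: "w = u @ x # v" "\<not> avoids (filter P u) (chi_tilde m [2, 4, 3, 1])"
  proof (cases "even m")
    case True
    then have "\<not> avoids w (chi_tilde m [2, 4, 3, 1] \<oplus> [1])"
      using Suc.prems unfolding chi_tilde_Suc[OF perm] by simp
    with that show thesis
      unfolding contains_oplus_one[OF chi_tilde_perms[OF perm]] by blast
  next
    case False
    then have "\<not> avoids w (chi_tilde m [2, 4, 3, 1] \<ominus> [1])"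
      using Suc.prems unfolding chi_tilde_Suc[OF perm] by simp
    with that show thesis
      unfolding contains_ominus_one[OF chi_tilde_perms[OF perm]] by blast
  qed
  have "subseq (filter P u) w"
    unfolding w(1) by (rule subseq_rev_drop_many) simp
  with Suc.IH[OF w(2)] show ?case
    using avoids_subseq by blast
qed

lemma avoids_self: "\<not> avoids \<tau> \<tau>"
  unfolding avoids_def order_isomorphic_def by blast

text \<open>The seed 2431 leads to the first alternative; the seeds 1 and 21 have the codes
  \<open>[]\<close> and \<open>[False]\<close> and lead to the second. The alternatives match the
  side condition under which \<open>swl\<close> is applied in the theorem.\<close>

lemma B_cases:
  assumes "\<tau> \<in> \<B>"
  obtains "\<not> avoids \<tau> [1, 3, 2]" "\<And>w. avoids w [1, 3, 2] \<Longrightarrow> avoids w \<tau>"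
  | bs where "\<tau> = code_perm bs" "successively (\<noteq>) bs" "avoids \<tau> [1, 3, 2]" "swl \<tau> = \<tau>"
proof -
  from assms obtain m where
    "\<tau> = chi_tilde m [1] \<or> \<tau> = chi_tilde m [2, 1] \<or> \<tau> = chi_tilde m [2, 4, 3, 1]"
    by (auto simp: \<B>_def)
  then consider "\<tau> = chi_tilde m [2, 4, 3, 1]" |
    bs where "\<tau> = chi_tilde m (code_perm bs)" "successively (\<noteq>) (True # bs)" "swu (rot (code_perm bs)) = rot (code_perm bs)"
  proof (elim disjE)
    assume "\<tau> = chi_tilde m [1]"
    with that(2)[of "[]"] rot_short swu_short show thesis by simp
  next
    assume "\<tau> = chi_tilde m [2, 1]"
    with that(2)[of "[False]"] rot_short swu_short show thesis
      by (simp add: ominus_def numeral_2_eq_2)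
  qed (use that(1) in blast)
  then show thesis
  proof cases
    case 1
    then show thesis
      using contains_chi_tilde_2431 avoids_self that(1) by blast
  next
    case 2
    then obtain cs where "\<tau> = code_perm cs" "successively (\<noteq>) (even m # cs)"
      using chi_tilde_code_perm by blast
    moreover have "swl \<tau> = \<tau>"
      using 2 swl_chi_tilde[OF code_perm_perms] by simp
    ultimately show thesis
      using code_perm_avoids_132 that(2)[of cs] by (auto simp: successively_Cons)
  qed
qed

section \<open>Gluing the bijections of the fibers\<close>

lemma stack_sort_perms_iff: "stack_sort \<sigma> \<in> perms n \<longleftrightarrow> \<sigma> \<in> perms n"
  by (simp add: permutations_of_set_def)

text \<open>Each \<open>\<sigma>\<close> is moved by the bijection of its own fiber and lands over
  \<open>h (stack_sort \<sigma>)\<close>. Injectivity of \<open>h\<close> keeps different fibers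
  apart, and surjectivity of \<open>h\<close> reaches every fiber.\<close>

lemma jointly_equidistributed_if_fibers:
  assumes X: "X \<subseteq> perms n" "X' \<subseteq> perms n"
    and h: "bij_betw h X X'"
    and fib: "\<And>\<pi>. \<pi> \<in> X \<Longrightarrow> \<exists>g. bij_betw g {\<sigma>. stack_sort \<sigma> = \<pi>} {\<sigma>. stack_sort \<sigma> = h \<pi>} \<and>
      (\<forall>\<sigma>. stack_sort \<sigma> = \<pi> \<longrightarrow> des (g \<sigma>) = des \<sigma> \<and> peak (g \<sigma>) = peak \<sigma> \<and> zeil (g \<sigma>) = zeil \<sigma>)"
  shows "jointly_equidistributed (stack_sort_preimage X) (stack_sort_preimage X')"
proof -
  have pre: "stack_sort_preimage Y = {\<sigma>. stack_sort \<sigma> \<in> Y}" if "Y \<subseteq> perms n" for Y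
    using that stack_sort_perms_iff by (auto simp: stack_sort_preimage_def)
  obtain G where G: "\<And>\<pi>. \<pi> \<in> X \<Longrightarrow> bij_betw (G \<pi>) {\<sigma>. stack_sort \<sigma> = \<pi>} {\<sigma>. stack_sort \<sigma> = h \<pi>}"
    and stat: "\<And>\<pi> \<sigma>. \<pi> \<in> X \<Longrightarrow> stack_sort \<sigma> = \<pi> \<Longrightarrow>
      des (G \<pi> \<sigma>) = des \<sigma> \<and> peak (G \<pi> \<sigma>) = peak \<sigma> \<and> zeil (G \<pi> \<sigma>) = zeil \<sigma>"
    using fib by metis
  define f where "f \<sigma> = G (stack_sort \<sigma>) \<sigma>" for \<sigma>
  have f: "stack_sort (f \<sigma>) = h (stack_sort \<sigma>)" if "stack_sort \<sigma> \<in> X" for \<sigma>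
    using bij_betwE[OF G[OF that]] by (simp add: f_def)
  have "bij_betw f {\<sigma>. stack_sort \<sigma> \<in> X} {\<sigma>. stack_sort \<sigma> \<in> X'}"
  proof (rule bij_betw_imageI)
    show "inj_on f {\<sigma>. stack_sort \<sigma> \<in> X}"
    proof (rule inj_onI)
      fix \<sigma> \<rho> assume *: "\<sigma> \<in> {\<sigma>. stack_sort \<sigma> \<in> X}" "\<rho> \<in> {\<sigma>. stack_sort \<sigma> \<in> X}" "f \<sigma> = f \<rho>"
      then have "h (stack_sort \<sigma>) = h (stack_sort \<rho>)"
        using f by (metis mem_Collect_eq)
      with * have eq: "stack_sort \<sigma> = stack_sort \<rho>"
        using bij_betw_imp_inj_on[OF h] by (auto dest: inj_onD)
      with *(2,3) show "\<sigma> = \<rho>"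
        using bij_betw_imp_inj_on[OF G, of "stack_sort \<rho>"] by (auto simp: f_def dest: inj_onD)
    qed
    show "f ` {\<sigma>. stack_sort \<sigma> \<in> X} = {\<sigma>. stack_sort \<sigma> \<in> X'}"
    proof
      show "f ` {\<sigma>. stack_sort \<sigma> \<in> X} \<subseteq> {\<sigma>. stack_sort \<sigma> \<in> X'}"
        using f bij_betwE[OF h] by auto
      show "{\<sigma>. stack_sort \<sigma> \<in> X'} \<subseteq> f ` {\<sigma>. stack_sort \<sigma> \<in> X}"
      proof clarify
        fix \<rho> assume "stack_sort \<rho> \<in> X'"
        then obtain \<pi> where \<pi>: "\<pi> \<in> X" "stack_sort \<rho> = h \<pi>"
          using bij_betw_imp_surj_on[OF h] by (metis imageE)
        then have "\<rho> \<in> G \<pi> ` {\<sigma>. stack_sort \<sigma> = \<pi>}"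
          using bij_betw_imp_surj_on[OF G[OF \<pi>(1)]] by simp
        with \<pi>(1) show "\<rho> \<in> f ` {\<sigma>. stack_sort \<sigma> \<in> X}"
          by (auto simp: f_def)
      qed
    qed
  qed
  then show ?thesis
    unfolding jointly_equidistributed_def pre[OF X(1)] pre[OF X(2)]
    using stat by (auto simp: f_def intro!: exI[of _ f])
qed

theorem theorem5p17:
  fixes I :: "nat set" and \<tau> :: "nat \<Rightarrow> nat list" and n :: nat
  assumes "\<forall>i \<in> I. \<tau> i \<in> \<B>"
  shows "jointly_equidistributed
           (stack_sort_preimage (Av n ({[1, 3, 2], [3, 4, 1, 2]} \<union> {\<tau> i |i. i \<in> I})))
           (stack_sort_preimage (Av n ({[3, 1, 2], [1, 3, 4, 2]} \<union>
              {swl (\<tau> i) |i. i \<in> I \<and> avoids (\<tau> i) [1, 3, 2]})))"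
    (is "jointly_equidistributed (stack_sort_preimage ?X) (stack_sort_preimage ?X')")
proof -
  \<comment> \<open>By \<open>B_cases\<close> the pattern has an alternating code and is fixed by
    \<open>swl\<close>, so \<open>swing_contains_code\<close> compares the same pattern in both
    words.\<close>
  have transfer: "avoids \<pi> (\<tau> i) \<longleftrightarrow> avoids \<pi>' (swl (\<tau> i))"
    if "swing \<pi> \<pi>'" "i \<in> I" "avoids (\<tau> i) [1, 3, 2]" for \<pi> \<pi>' i
  proof -
    from assms that(2) have "\<tau> i \<in> \<B>" by blast
    then show ?thesis
      using that(3) swing_contains_code[OF that(1)] by (cases rule: B_cases) (auto simp: contains_code_iff)
  qed
  \<comment> \<open>These patterns have no counterpart in the second set, but a word avoiding 132
    avoids them automatically.\<close>
  have trivial: "avoids \<pi> (\<tau> i)" if "avoids \<pi> [1, 3, 2]" "i \<in> I" "\<not> avoids (\<tau> i) [1, 3, 2]" for \<pi> i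
  proof -
    from assms that(2) have "\<tau> i \<in> \<B>" by blast
    then show ?thesis
      using that(1,3) by (cases rule: B_cases) auto
  qed
  have mem: "\<pi> \<in> ?X \<longleftrightarrow> \<pi>' \<in> ?X'" if sw: "swing \<pi> \<pi>'" for \<pi> \<pi>'
    using swing_perms[OF sw, of n] swing_avoids[OF sw] transfer[OF sw] trivial[of \<pi>]
    by (auto simp: Av_def)
  have ex: "\<exists>\<pi>'. swing \<pi> \<pi>'" if "\<pi> \<in> ?X" for \<pi>
    using that by (intro swing_exists) (auto simp: Av_def permutations_of_set_def)
  have ex': "\<exists>\<pi>. swing \<pi> \<pi>'" if "\<pi>' \<in> ?X'" for \<pi>'
    using that by (intro swing_exists_left) (auto simp: Av_def permutations_of_set_def)
  \<comment> \<open>The choice is forced by \<open>swing_unique\<close>, which is what makes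
    \<open>h\<close> reach every swung word.\<close>
  define h where "h \<pi> = (SOME \<pi>'. swing \<pi> \<pi>')" for \<pi>
  have h: "swing \<pi> (h \<pi>)" if "\<pi> \<in> ?X" for \<pi>
    unfolding h_def using ex[OF that] by (rule someI_ex)
  have "bij_betw h ?X ?X'"
  proof (rule bij_betw_imageI)
    show "inj_on h ?X"
    proof (rule inj_onI)
      fix \<pi> \<rho> assume "\<pi> \<in> ?X" "\<rho> \<in> ?X" "h \<pi> = h \<rho>"
      then have "swing \<pi> (h \<rho>)" "swing \<rho> (h \<rho>)"
        using h[of \<pi>] h[of \<rho>] by simp_all
      then show "\<pi> = \<rho>"
        by (rule swing_unique_left)
    qed
    show "h ` ?X = ?X'"
    proof
      show "h ` ?X \<subseteq> ?X'"
        using h mem by blast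
      show "?X' \<subseteq> h ` ?X"
      proof
        fix \<pi>' assume \<pi>': "\<pi>' \<in> ?X'"
        then obtain \<pi> where \<pi>: "swing \<pi> \<pi>'"
          using ex' by blast
        with \<pi>' mem have "\<pi> \<in> ?X" by blast
        with h \<pi> swing_unique show "\<pi>' \<in> h ` ?X" by blast
      qed
    qed
  qed
  then show ?thesis
  proof (rule jointly_equidistributed_if_fibers[rotated 2])
    show "?X \<subseteq> perms n" "?X' \<subseteq> perms n"
      by (auto simp: Av_def)
    fix \<pi> assume "\<pi> \<in> ?X"
    with h show "\<exists>g. bij_betw g {\<sigma>. stack_sort \<sigma> = \<pi>} {\<sigma>. stack_sort \<sigma> = h \<pi>} \<and>
      (\<forall>\<sigma>. stack_sort \<sigma> = \<pi> \<longrightarrow> des (g \<sigma>) = des \<sigma> \<and> peak (g \<sigma>) = peak \<sigma> \<and> zeil (g \<sigma>) = zeil \<sigma>)"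
      by (intro swing_fiber_bij) (auto simp: Av_def)
  qed
qed

end
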